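(* Let $a\in\mathbb{Z}$, let $\tau=u+iv$ be in the complex upper half-plane, and let $z=x+iy\in\mathbb{C}$ with $z\notin\mathbb{Z}\tau+\mathbb{Z}$. Let $Y_0^+=i\frac{\partial}{\partial z}$ be the raising operator of index $0$. Then $$Y_0^+\left(\widehat{\mathcal{E}}_{2-a}(z;\tau)\right)=-2\pi\,\widehat{\mathcal{E}}_{3-a}(z;\tau).$$
   Context: $\frac{\partial}{\partial z}=\frac12\left(\frac{\partial}{\partial x}-i\frac{\partial}{\partial y}\right)$. Notation: $q=e^{2\pi i\tau}$, $\zeta=e^{2\pi i z}$, $\lfloor\cdot\rfloor$ floor, $\{t\}=t-\lfloor t\rfloor$, $B_n(t)$ the $n$-th Bernoulli polynomial, $\Gamma^*(n,w)=\frac{\Gamma(n,w)}{\Gamma(n)}=e^{-w}\sum_{k=0}^{n-1}\frac{w^k}{k!}$ for integers $n\ge1$. For $a\in\mathbb{Z}$, $$\mathcal{E}_{2-a}(z;\tau)=\sum_{n\in\mathbb{Z}\setminus\{0\}}\frac{\zeta^n}{n^{a-1}(1-q^n)}.$$ For $a\ge2$ this is used for $0\le y<v$ (with $z\notin\mathbb{Z}$ if $a=2$); for $a\le1$ the series is used for $0<y<v$ and $z\mapsto\mathcal{E}_{2-a}(z;\tau)$ denotes its meromorphic continuation to $\mathbb{C}$, which has poles only at points of $\mathbb{Z}\tau+\mathbb{Z}$. For $a\le1$: $$\widehat{\mathcal{E}}_{2-a}(z;\tau)=\begin{cases}\mathcal{E}_1(z;\tau)-\frac yv+\frac12&\text{if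 }a=1,\\ \mathcal{E}_2(z;\tau)+\frac1{4\pi v}&\text{if }a=0,\\ \mathcal{E}_{2-a}(z;\tau)&\text{if }a\le-1.\end{cases}$$ For $a\ge2$: $$\widehat{\mathcal{E}}_{2-a}(z;\tau)=\mathcal{E}_{2-a}\left(z-\left\lfloor\tfrac yv\right\rfloor\tau;\tau\right)-\frac{(-4\pi v)^{a-1}B_a\left(\left\{\frac yv\right\}\right)}{a!}+\mathcal{E}^-_{2-a}(z;\tau),$$ $$\mathcal{E}^-_{2-a}(z;\tau)=\sum_{\substack{m\ge1\\ \ell\ge1+\lfloor y/v\rfloor}}\frac{\Gamma^*\left(a-1,4\pi m\left(\ell-\frac yv\right)v\right)}{m^{a-1}}e^{2\pi i m(z-\ell\tau)}+(-1)^a\sum_{\substack{m\ge1\\ \ell\ge-\lfloor y/v\rfloor}}\frac{\Gamma^*\left(a-1,4\pi m\left(\ell+\frac yv\right)v\right)}{m^{a-1}}e^{-2\pi i m(z+\ell\tau)}.$$ *)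

theory Defs
  imports
    "HOL-Complex_Analysis.Complex_Analysis"
    "HOL-Computational_Algebra.Formal_Power_Series"
begin

definition period_lattice :: "complex \<Rightarrow> complex set" where
  "period_lattice \<tau> = {of_int m * \<tau> + of_int n |m n. True}"

definition has_partials_at :: "(complex \<Rightarrow> complex) \<Rightarrow> complex \<Rightarrow> bool" where
  "has_partials_at f z \<longleftrightarrow>
     (\<lambda>x::real. f (Complex x (Im z))) differentiable at (Re z) \<and>
     (\<lambda>y::real. f (Complex (Re z) y)) differentiable at (Im z)"

definition partial_x :: "(complex \<Rightarrow> complex) \<Rightarrow> complex \<Rightarrow> complex" where
  "partial_x f z = vector_derivative (\<lambda>x::real. f (Complex x (Im z))) (at (Re z))"

definition partial_y :: "(complex \<Rightarrow> complex) \<Rightarrow> complex \<Rightarrow> complex" where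
  "partial_y f z = vector_derivative (\<lambda>y::real. f (Complex (Re z) y)) (at (Im z))"

definition partial_z :: "(complex \<Rightarrow> complex) \<Rightarrow> complex \<Rightarrow> complex" where
  "partial_z f z = (1/2) * (partial_x f z - \<i> * partial_y f z)"

definition Y0_plus :: "(complex \<Rightarrow> complex) \<Rightarrow> complex \<Rightarrow> complex" where
  "Y0_plus f z = \<i> * partial_z f z"

text \<open>Generating function: \<open>t exp(x t) / (exp(t) - 1)\<close> is the sum of the \<open>B\<^sub>n(x) t\<^sup>n / n!\<close>.\<close>

definition bernoulli_poly :: "nat \<Rightarrow> real \<Rightarrow> real" where
  "bernoulli_poly n x = fact n * fps_nth (fps_X * fps_exp x / (fps_exp 1 - 1)) n"

text \<open>The normalised incomplete Gamma function \<open>\<Gamma>(n, w) / \<Gamma>(n)\<close> for integers \<open>n \<ge> 1\<close>.\<close>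

definition Gamma_star :: "nat \<Rightarrow> real \<Rightarrow> real" where
  "Gamma_star n w = exp (- w) * (\<Sum>k<n. w ^ k / fact k)"

text \<open>
  All functions below carry the subscript \<open>k = 2 - a\<close> of the mathematical notation as their
  first argument, so \<open>a \<ge> 2\<close> means \<open>k \<le> 0\<close>.
\<close>

definition E_term :: "int \<Rightarrow> complex \<Rightarrow> complex \<Rightarrow> int \<Rightarrow> complex" where
  "E_term k z \<tau> n =
     (let a = 2 - k; q = exp (2 * of_real pi * \<i> * \<tau>); \<zeta> = exp (2 * of_real pi * \<i> * z)
      in \<zeta> powi n / (of_int n powi (a - 1) * (1 - q powi n)))"

text \<open>
  The sum over all nonzero integers is taken as the sum over the positive ones plus the sum over
  the negative ones. For \<open>a = 2\<close> and real \<open>z\<close> the former converges only conditionally, so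
  an unordered sum (\<^const>\<open>infsum\<close>) would not do.
\<close>

definition E_series :: "int \<Rightarrow> complex \<Rightarrow> complex \<Rightarrow> complex" where
  "E_series k z \<tau> =
     (\<Sum>j. E_term k z \<tau> (int (Suc j))) + (\<Sum>j. E_term k z \<tau> (- int (Suc j)))"

text \<open>
  A \<^const>\<open>nicely_meromorphic_on\<close> function has no removable singularities and takes the value 0 at
  its poles, which makes the continuation unique as a function.
\<close>

definition is_E_continuation :: "int \<Rightarrow> complex \<Rightarrow> (complex \<Rightarrow> complex) \<Rightarrow> bool" where
  "is_E_continuation k \<tau> f \<longleftrightarrow>
     f nicely_meromorphic_on UNIV \<and>
     (\<forall>z. 0 < Im z \<and> Im z < Im \<tau> \<longrightarrow> f z = E_series k z \<tau>)"

lemma is_E_continuation_unique: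
  assumes \<tau>: "Im \<tau> > 0" and f: "is_E_continuation k \<tau> f" and g: "is_E_continuation k \<tau> g"
  shows "f = g"
proof -
  define S where "S = {z. 0 < Im z} \<inter> {z. Im z < Im \<tau>}"
  have S: "open S" unfolding S_def
    by (intro open_Int open_halfspace_Im_gt open_halfspace_Im_lt)
  have nf: "f nicely_meromorphic_on UNIV" and ng: "g nicely_meromorphic_on UNIV"
    using f g by (auto simp: is_E_continuation_def)
  have mf: "f meromorphic_on UNIV" and mg: "g meromorphic_on UNIV"
    using nf ng by (auto simp: nicely_meromorphic_on_def)
  define h where "h = remove_sings (\<lambda>z. f z - g z)"
  have md: "(\<lambda>z. f z - g z) meromorphic_on UNIV"
    by (intro meromorphic_intros mf mg)
  have nh: "h nicely_meromorphic_on UNIV"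
    unfolding h_def by (rule remove_sings_nicely_meromorphic[OF md])
  have hS: "h z = 0" if z: "z \<in> S" for z
  proof -
    have "eventually (\<lambda>w. w \<in> S) (nhds z)"
      using S z by (rule eventually_nhds_in_open)
    hence "eventually (\<lambda>w. f w - g w = 0) (nhds z)"
      by eventually_elim (use f g in \<open>auto simp: S_def is_E_continuation_def\<close>)
    hence "eventually (\<lambda>w. f w - g w = 0) (at z)"
      by (simp add: eventually_nhds_conv_at)
    hence "(\<lambda>w. f w - g w) \<midarrow>z\<rightarrow> 0"
      by (rule tendsto_eventually)
    thus ?thesis unfolding h_def by (rule remove_sings_eqI)
  qed
  have "Complex 0 (Im \<tau> / 2) \<in> S" using \<tau> by (auto simp: S_def)
  hence ne: "S \<noteq> {}" by auto
  have "h constant_on UNIV"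
    by (rule constant_on_extend_nicely_meromorphic_on[OF nh _ S _ _ ne])
       (auto simp: constant_on_def hS)
  hence h0: "h z = 0" for z
    using hS ne by (metis UNIV_I constant_on_def ex_in_conv)
  have ev: "eventually (\<lambda>w. f w = g w) (at z)" for z
  proof -
    have "eventually (\<lambda>z. h z = f z - g z) (cosparse UNIV)"
      unfolding h_def by (rule eventually_remove_sings_eq[OF md])
    hence "eventually (\<lambda>w. h w = f w - g w) (at z)"
      by (simp add: eventually_cosparse_open_eq)
    thus ?thesis by eventually_elim (simp add: h0)
  qed
  show ?thesis
  proof
    fix z
    have 1: "(is_pole f z \<and> f z = 0) \<or> f \<midarrow>z\<rightarrow> f z" and 2: "(is_pole g z \<and> g z = 0) \<or> g \<midarrow>z\<rightarrow> g z"
      using nf ng by (auto simp: nicely_meromorphic_on_def)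
    have 3: "is_pole f z \<longleftrightarrow> is_pole g z"
      using ev[of z] by (rule is_pole_cong) simp
    have 4: "f \<midarrow>z\<rightarrow> c \<longleftrightarrow> g \<midarrow>z\<rightarrow> c" for c
      using ev[of z] by (rule tendsto_cong)
    have 5: "\<not> is_pole g z" if "g \<midarrow>z\<rightarrow> c" for c
      using that by (metis at_neq_bot is_pole_def not_tendsto_and_filterlim_at_infinity)
    show "f z = g z" using 1 2 3 4 5 LIM_unique by metis
  qed
qed

definition E_fun :: "int \<Rightarrow> complex \<Rightarrow> complex \<Rightarrow> complex" where
  "E_fun k z \<tau> =
     (if k \<ge> 1 then (THE f. is_E_continuation k \<tau> f) z else E_series k z \<tau>)"

text \<open>
  The double sums are iterated sums with \<open>m\<close> as the inner variable. For \<open>a = 2\<close> and integral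
  \<open>Im z / Im \<tau>\<close> they do not converge absolutely, because of the terms of the second sum with
  \<open>l = - Im z / Im \<tau>\<close>.
\<close>

definition E_minus :: "int \<Rightarrow> complex \<Rightarrow> complex \<Rightarrow> complex" where
  "E_minus k z \<tau> =
     (let a = 2 - k; y = Im z; v = Im \<tau>; N = \<lfloor>y / v\<rfloor> in
       (\<Sum>j. \<Sum>i. let l = 1 + N + int j; m = Suc i in
          of_real (Gamma_star (nat (a - 1)) (4 * pi * real m * (of_int l - y / v) * v))
            / of_nat m powi (a - 1)
            * exp (2 * of_real pi * \<i> * of_nat m * (z - of_int l * \<tau>)))
     + (- 1) powi a *
       (\<Sum>j. \<Sum>i. let l = - N + int j; m = Suc i in
          of_real (Gamma_star (nat (a - 1)) (4 * pi * real m * (of_int l + y / v) * v))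
            / of_nat m powi (a - 1)
            * exp (- 2 * of_real pi * \<i> * of_nat m * (z + of_int l * \<tau>))))"

definition E_hat :: "int \<Rightarrow> complex \<Rightarrow> complex \<Rightarrow> complex" where
  "E_hat k z \<tau> =
     (let a = 2 - k; y = Im z; v = Im \<tau> in
      if a = 1 then E_fun k z \<tau> - of_real (y / v) + 1 / 2
      else if a = 0 then E_fun k z \<tau> + 1 / of_real (4 * pi * v)
      else if a \<le> - 1 then E_fun k z \<tau>
      else E_fun k (z - of_int \<lfloor>y / v\<rfloor> * \<tau>) \<tau>
           - of_real ((- 4 * pi * v) powi (a - 1) * bernoulli_poly (nat a) (frac (y / v))
               / fact (nat a))
           + E_minus k z \<tau>)"

end

theory Submission
  imports Defs
begin

text \<open>
  Write \<open>n = a - 1\<close>. Expanding \<open>1 / (1 - q\<^sup>m)\<close> and \<open>\<Gamma>\<^sup>*\<close> turns \<open>E_hat\<close> for \<open>n \<ge> 0\<close> into a sum over the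
  translates of \<open>z\<close> by \<open>\<tau>\<close> of polylogarithms in \<open>\<zeta>\<close> and, with polynomial factors in \<open>Im z\<close>, in
  \<open>cnj \<zeta>\<close>. The holomorphic derivative \<open>\<partial>/\<partial>z\<close> lowers the order of each piece by one, and the
  Bernoulli term behaves in the same way, so the identity holds in the open strip \<open>0 < Im z < Im \<tau>\<close>.
  By periodicity it remains to treat real \<open>z\<close>, where the formulas from above and below are
  real-analytic across the line (the polylogarithm continues to \<open>Re w < 1\<close>) and their values and
  first derivatives agree there; the jump of \<open>B\<^sub>n({y/v})\<close> is exactly what makes them agree.
  For \<open>n < 0\<close> the functions are meromorphic and the identity extends from the strip by uniqueness.
\<close>

section \<open>Wirtinger derivatives\<close>

text \<open>The formula for \<open>E_hat\<close> switches where \<open>Im z / Im \<tau>\<close> is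
  an integer, and \<open>partial_z\<close> at such a point differentiates across the switch. Two
  formulas can be glued there if both are real-differentiable at the point with the same value and
  the same derivative; for this comparison the derivative by \<open>cnj z\<close> is carried along
  too. Only the untranslated terms are delicate: for real \<open>z\<close> both \<open>ee z\<close>
  and \<open>ee (- z)\<close> lie on the unit circle, at the edge of convergence. The half-plane
  \<open>Re w < 1\<close> is chosen since it is convex, so that primitives exist, and contains the
  closed unit disc without 1, hence both points unless \<open>z\<close> is an integer. The other
  translates stay inside the disc for \<open>\<bar>Im z\<bar> < Im \<tau>\<close>. The case
  \<open>a = 1\<close> joins the same family as \<open>n = 0\<close>: the nonholomorphic sums are
  empty and the Bernoulli term is \<open>- y / v + 1 / 2\<close>. So \<open>a = 2\<close> needs no
  separate derivative formula.\<close>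

definition has_wirtinger :: "(complex \<Rightarrow> complex) \<Rightarrow> complex \<Rightarrow> complex \<Rightarrow> complex \<Rightarrow> bool" where
  "has_wirtinger f A B z \<longleftrightarrow> (f has_derivative (\<lambda>h. A * h + B * cnj h)) (at z)"

text \<open>Along the directions 1 and \<open>\<i>\<close> the derivative is \<open>A + B\<close>
  and \<open>\<i> * (A - B)\<close>; \<open>partial_z\<close> recovers \<open>A\<close> from
  these.\<close>

lemma has_wirtinger_imp_partials:
  assumes "has_wirtinger f A B z"
  shows "has_partials_at f z" and "partial_z f z = A"
proof -
  have f: "(f has_derivative (\<lambda>h. A * h + B * cnj h)) (at z)"
    using assms by (simp add: has_wirtinger_def)
  have cx: "((\<lambda>x::real. Complex x (Im z)) has_derivative (\<lambda>h. of_real h)) (at (Re z))"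
    by (auto intro!: derivative_eq_intros simp: Complex_eq)
  have cy: "((\<lambda>y::real. Complex (Re z) y) has_derivative (\<lambda>h. \<i> * of_real h)) (at (Im z))"
    by (auto intro!: derivative_eq_intros simp: Complex_eq)
  have "((\<lambda>x. f (Complex x (Im z))) has_derivative (\<lambda>h. A * of_real h + B * cnj (of_real h))) (at (Re z))"
    by (rule has_derivative_compose[OF cx]) (use f in simp)
  hence X: "((\<lambda>x. f (Complex x (Im z))) has_vector_derivative (A + B)) (at (Re z))"
    by (simp add: has_vector_derivative_def scaleR_conv_of_real algebra_simps)
  have "((\<lambda>y. f (Complex (Re z) y)) has_derivative
          (\<lambda>h. A * (\<i> * of_real h) + B * cnj (\<i> * of_real h))) (at (Im z))"
    by (rule has_derivative_compose[OF cy]) (use f in simp)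
  hence Y: "((\<lambda>y. f (Complex (Re z) y)) has_vector_derivative (\<i> * (A - B))) (at (Im z))"
    by (simp add: has_vector_derivative_def scaleR_conv_of_real algebra_simps)
  show "has_partials_at f z"
    using X Y by (auto simp: has_partials_at_def intro: differentiableI_vector)
  show "partial_z f z = A"
    unfolding partial_z_def partial_x_def partial_y_def vector_derivative_at[OF X]
      vector_derivative_at[OF Y] by (simp add: algebra_simps)
qed

lemma has_wirtinger_eq_rhs:
  "has_wirtinger f A B z \<Longrightarrow> A = A' \<Longrightarrow> B = B' \<Longrightarrow> has_wirtinger f A' B' z"
  by simp

lemma has_wirtinger_cong_ev:
  assumes "has_wirtinger f A B z" "eventually (\<lambda>w. f w = g w) (nhds z)"
  shows "has_wirtinger g A B z"
proof -
  have "f z = g z" "eventually (\<lambda>w. f w = g w) (at z)"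
    using assms(2) by (auto simp: eventually_nhds_conv_at)
  with assms(1) show ?thesis
    unfolding has_wirtinger_def by (blast intro: has_derivative_transform_eventually)
qed

lemma has_wirtinger_holomorphic:
  "(f has_field_derivative d) (at z) \<Longrightarrow> has_wirtinger f d 0 z"
  by (simp add: has_wirtinger_def has_field_derivative_def)

lemma has_wirtinger_cnj:
  assumes "(f has_field_derivative d) (at (cnj z))"
  shows "has_wirtinger (\<lambda>w. f (cnj w)) 0 d z"
proof -
  have c: "(cnj has_derivative cnj) (at z)"
    by (rule bounded_linear_imp_has_derivative[OF bounded_linear_cnj])
  show ?thesis
    using has_derivative_compose[OF c, of f "\<lambda>h. d * h"] assms
    by (simp add: has_wirtinger_def has_field_derivative_def)
qed

lemma has_wirtinger_Im:
  assumes "(\<phi> has_real_derivative d) (at (Im z))"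
  shows "has_wirtinger (\<lambda>w. of_real (\<phi> (Im w))) (- (\<i> / 2) * of_real d) (\<i> / 2 * of_real d) z"
proof -
  have "(Im has_derivative Im) (at z)"
    by (rule bounded_linear_imp_has_derivative[OF bounded_linear_Im])
  from has_derivative_compose[OF this, of \<phi> "\<lambda>h. d * h"] assms
  have "((\<lambda>w. \<phi> (Im w)) has_derivative (\<lambda>h. d * Im h)) (at z)"
    by (simp add: has_field_derivative_def)
  hence "((\<lambda>w. complex_of_real (\<phi> (Im w))) has_derivative (\<lambda>h. of_real (d * Im h))) (at z)"
    by (rule has_derivative_of_real)
  also have "(\<lambda>h. complex_of_real (d * Im h)) =
      (\<lambda>h. - (\<i> / 2) * of_real d * h + \<i> / 2 * of_real d * cnj h)"
    by (rule ext) (auto simp: complex_eq_iff)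
  finally show ?thesis by (simp add: has_wirtinger_def)
qed

lemma has_wirtinger_add:
  "has_wirtinger f A B z \<Longrightarrow> has_wirtinger g C D z \<Longrightarrow>
     has_wirtinger (\<lambda>w. f w + g w) (A + C) (B + D) z"
  unfolding has_wirtinger_def
  by (drule (1) has_derivative_add) (simp add: algebra_simps)

lemma has_wirtinger_diff:
  "has_wirtinger f A B z \<Longrightarrow> has_wirtinger g C D z \<Longrightarrow>
     has_wirtinger (\<lambda>w. f w - g w) (A - C) (B - D) z"
  unfolding has_wirtinger_def
  by (drule (1) has_derivative_diff) (simp add: algebra_simps)

lemma has_wirtinger_mult:
  "has_wirtinger f A B z \<Longrightarrow> has_wirtinger g C D z \<Longrightarrow>
     has_wirtinger (\<lambda>w. f w * g w) (A * g z + f z * C) (B * g z + f z * D) z"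
  unfolding has_wirtinger_def
  by (drule (1) has_derivative_mult) (simp add: algebra_simps)

lemma has_wirtinger_cmult:
  "has_wirtinger f A B z \<Longrightarrow> has_wirtinger (\<lambda>w. c * f w) (c * A) (c * B) z"
  unfolding has_wirtinger_def
  by (drule has_derivative_mult_right[of _ _ _ c]) (simp add: algebra_simps)

lemma has_wirtinger_sum:
  "(\<And>i. i \<in> I \<Longrightarrow> has_wirtinger (f i) (A i) (B i) z) \<Longrightarrow>
     has_wirtinger (\<lambda>w. \<Sum>i\<in>I. f i w) (\<Sum>i\<in>I. A i) (\<Sum>i\<in>I. B i) z"
  unfolding has_wirtinger_def
  by (drule has_derivative_sum) (simp add: sum.distrib sum_distrib_right)

lemma has_wirtinger_shift:
  assumes "has_wirtinger f A B (z + c)"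
  shows "has_wirtinger (\<lambda>w. f (w + c)) A B z"
proof -
  have "((\<lambda>w. w + c) has_derivative (\<lambda>h. h)) (at z)"
    by (auto intro!: derivative_eq_intros)
  from has_derivative_compose[OF this] assms show ?thesis
    by (simp add: has_wirtinger_def)
qed

lemma has_wirtinger_minus:
  assumes "has_wirtinger f A B (- z)"
  shows "has_wirtinger (\<lambda>w. f (- w)) (- A) (- B) z"
proof -
  have "((\<lambda>w. - w) has_derivative (\<lambda>h. - h)) (at z)"
    by (auto intro!: derivative_eq_intros)
  from has_derivative_compose[OF this, of f "\<lambda>h. A * h + B * cnj h"] assms show ?thesis
    by (simp add: has_wirtinger_def)
qed

text \<open>\<open>P\<close> is arbitrary: the remainder quotients of both functions tend to 0, so
  any choice between them does. This glues two formulas along a line without one-sided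
  derivatives.\<close>

lemma has_wirtinger_If:
  assumes f: "has_wirtinger f A B z" and g: "has_wirtinger g A B z" and eq: "f z = g z"
  shows "has_wirtinger (\<lambda>w. if P w then f w else g w) A B z"
proof -
  let ?D = "\<lambda>h. A * h + B * cnj h" and ?F = "\<lambda>w. if P w then f w else g w"
  have *: "bounded_linear ?D" "((\<lambda>w. (f w - f z - ?D (w - z)) /\<^sub>R norm (w - z)) \<longlongrightarrow> 0) (at z)"
    "((\<lambda>w. (g w - g z - ?D (w - z)) /\<^sub>R norm (w - z)) \<longlongrightarrow> 0) (at z)"
    using f g by (simp_all add: has_wirtinger_def has_derivative_at_within inverse_eq_divide)
  have "((\<lambda>w. if P w then (f w - f z - ?D (w - z)) /\<^sub>R norm (w - z)
          else (g w - g z - ?D (w - z)) /\<^sub>R norm (w - z)) \<longlongrightarrow> 0) (at z)"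
    by (rule filterlim_If) (rule tendsto_mono[OF inf_le1 *(2)], rule tendsto_mono[OF inf_le1 *(3)])
  also have "(\<lambda>w. if P w then (f w - f z - ?D (w - z)) /\<^sub>R norm (w - z)
          else (g w - g z - ?D (w - z)) /\<^sub>R norm (w - z)) =
        (\<lambda>w. (?F w - ?F z - ?D (w - z)) /\<^sub>R norm (w - z))"
    by (rule ext) (auto simp: eq)
  finally show ?thesis using *(1)
    by (simp add: has_wirtinger_def has_derivative_at_within inverse_eq_divide)
qed

text \<open>A common summable bound on both coefficients makes the partial sums of the derivatives
  converge uniformly relative to \<open>norm h\<close>, as termwise differentiation in the plane
  requires.\<close>

lemma has_wirtinger_suminf:
  assumes S: "convex S" "open S" "z \<in> S"
    and f: "\<And>n w. w \<in> S \<Longrightarrow> has_wirtinger (f n) (A n w) (B n w) w"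
    and A: "\<And>n w. w \<in> S \<Longrightarrow> norm (A n w) \<le> M n"
    and B: "\<And>n w. w \<in> S \<Longrightarrow> norm (B n w) \<le> M n"
    and M: "summable M" and sf: "\<And>w. w \<in> S \<Longrightarrow> summable (\<lambda>n. f n w)"
  shows "has_wirtinger (\<lambda>w. \<Sum>n. f n w) (\<Sum>n. A n z) (\<Sum>n. B n z) z"
proof -
  have sA: "summable (\<lambda>n. norm (A n w))" and sB: "summable (\<lambda>n. norm (B n w))" if "w \<in> S" for w
    by (rule summable_comparison_test'[OF M, of 0]; simp add: A[OF that] B[OF that])+
  let ?G = "\<lambda>w h. (\<Sum>n. A n w) * h + (\<Sum>n. B n w) * cnj h"
  have unif: "\<forall>\<^sub>F n in sequentially. \<forall>w\<in>S. \<forall>h.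
      norm ((\<Sum>i<n. A i w * h + B i w * cnj h) - ?G w h) \<le> e * norm h" if e: "e > 0" for e
  proof -
    \<comment> \<open>The tails of both coefficient series are dominated by that of
      \<open>M\<close>; each receives half of \<open>e\<close>.\<close>
    have "(\<lambda>n. suminf M - sum M {..<n}) \<longlonglongrightarrow> suminf M - suminf M"
      by (intro tendsto_intros summable_LIMSEQ M)
    hence "\<forall>\<^sub>F n in sequentially. suminf M - sum M {..<n} < e / 2"
      by (rule order_tendstoD) (use e in auto)
    thus ?thesis
    proof eventually_elim
      case (elim n)
      have tail: "norm ((\<Sum>i<n. C i) - suminf C) \<le> e / 2"
        if C: "\<And>i. norm (C i) \<le> M i" for C :: "nat \<Rightarrow> complex"
      proof -
        have s: "summable C" by (rule summable_comparison_test'[OF M, of 0]) (use C in auto)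
        have "norm ((\<Sum>i<n. C i) - suminf C) = norm (\<Sum>i. C (i + n))"
          using suminf_split_initial_segment[OF s, of n] by (simp add: norm_minus_commute)
        also have "\<dots> \<le> (\<Sum>i. M (i + n))"
          by (rule norm_suminf_le) (use C M in \<open>auto simp: summable_iff_shift\<close>)
        also have "\<dots> = suminf M - sum M {..<n}"
          using suminf_split_initial_segment[OF M, of n] by simp
        finally show ?thesis using elim by linarith
      qed
      show ?case
      proof (intro ballI allI)
        fix w h assume w: "w \<in> S"
        have "(\<Sum>i<n. A i w * h + B i w * cnj h) - ?G w h =
          ((\<Sum>i<n. A i w) - (\<Sum>n. A n w)) * h + ((\<Sum>i<n. B i w) - (\<Sum>n. B n w)) * cnj h"
          by (simp add: sum.distrib left_diff_distrib flip: sum_distrib_right)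
        also have "norm \<dots> \<le> norm ((\<Sum>i<n. A i w) - (\<Sum>n. A n w)) * norm h +
            norm ((\<Sum>i<n. B i w) - (\<Sum>n. B n w)) * norm h"
          by (rule order_trans[OF norm_triangle_ineq]) (simp add: norm_mult)
        also have "\<dots> \<le> e / 2 * norm h + e / 2 * norm h"
          by (intro add_mono mult_right_mono tail A[OF w] B[OF w]) auto
        finally show "norm ((\<Sum>i<n. A i w * h + B i w * cnj h) - ?G w h) \<le> e * norm h"
          by simp
      qed
    qed
  qed
  have "\<exists>g. \<forall>x\<in>S. (\<lambda>n. f n x) sums g x \<and> (g has_derivative ?G x) (at x within S)"
  proof (rule has_derivative_series[where f' = "\<lambda>n w h. A n w * h + B n w * cnj h"])
    show "(\<lambda>n. f n z) sums (\<Sum>n. f n z)" by (rule summable_sums[OF sf[OF S(3)]])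
    show "(f n has_derivative (\<lambda>h. A n x * h + B n x * cnj h)) (at x within S)"
      if "x \<in> S" for n x
      using f[OF that, of n] by (auto simp: has_wirtinger_def intro: has_derivative_at_withinI)
  qed (use S unif in auto)
  then obtain g where g: "\<And>x. x \<in> S \<Longrightarrow> (\<lambda>n. f n x) sums g x"
      "\<And>x. x \<in> S \<Longrightarrow> (g has_derivative ?G x) (at x within S)" by blast
  have "has_wirtinger g (\<Sum>n. A n z) (\<Sum>n. B n z) z"
    using g(2)[OF S(3)] S by (simp add: has_wirtinger_def at_within_open[OF S(3) S(2)])
  moreover have "eventually (\<lambda>w. g w = (\<Sum>n. f n w)) (nhds z)"
    using eventually_nhds_in_open[OF S(2,3)]
    by eventually_elim (use g(1) in \<open>auto simp: sums_iff\<close>)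
  ultimately show ?thesis by (rule has_wirtinger_cong_ev)
qed

section \<open>Polylogarithms\<close>

definition ee :: "complex \<Rightarrow> complex" where
  "ee z = exp (2 * of_real pi * \<i> * z)"

lemma ee_add: "ee (z + w) = ee z * ee w"
  by (simp add: ee_def exp_add ring_distribs)

lemma ee_minus: "ee (- z) = inverse (ee z)"
  by (simp add: ee_def exp_minus)

lemma ee_diff: "ee (z - w) = ee z / ee w"
  by (simp add: ee_def exp_diff right_diff_distrib)

lemma ee_nonzero [simp]: "ee z \<noteq> 0"
  by (simp add: ee_def)

lemma cnj_ee: "cnj (ee z) = ee (- cnj z)"
  by (simp add: ee_def exp_cnj)

lemma ee_of_nat_mult: "ee (of_nat n * z) = ee z ^ n"
  by (simp add: ee_def exp_of_nat_mult[symmetric] mult_ac)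

lemma norm_ee: "norm (ee z) = exp (- 2 * pi * Im z)"
  by (simp add: ee_def)

lemma norm_ee_less_1_iff: "norm (ee z) < 1 \<longleftrightarrow> 0 < Im z"
  by (simp add: norm_ee zero_less_mult_iff)

lemma norm_ee_le_1_iff: "norm (ee z) \<le> 1 \<longleftrightarrow> 0 \<le> Im z"
  by (simp add: norm_ee zero_le_mult_iff linorder_not_le[THEN iffD2, OF pi_gt_zero])

lemma ee_eq_1_iff: "ee z = 1 \<longleftrightarrow> z \<in> \<int>"
proof -
  have "ee z = 1 \<longleftrightarrow> (\<exists>n::int. z = of_int n)"
    unfolding ee_def exp_eq_1
    by (auto simp: complex_eq_iff)
  thus ?thesis by (auto simp: Ints_def)
qed

text \<open>Places the closed unit disc without 1 inside the domain where \<open>polylog\<close> is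
  analytic.\<close>

lemma Re_less_1_if_norm_le_1:
  assumes "norm (w::complex) \<le> 1" "w \<noteq> 1"
  shows "Re w < 1"
proof (rule ccontr)
  assume *: "\<not> Re w < 1"
  have "(Re w)\<^sup>2 + (Im w)\<^sup>2 \<le> 1"
    using assms(1) by (simp add: cmod_def)
  moreover have "1 \<le> (Re w)\<^sup>2" using * by (simp add: one_le_power)
  ultimately have "(Im w)\<^sup>2 = 0" "(Re w)\<^sup>2 = 1"
    using zero_le_power2[of "Im w"] by linarith+
  hence "Im w = 0" "Re w = 1" using * by (auto simp: power2_eq_1_iff)
  with assms(2) show False by (simp add: complex_eq_iff)
qed

lemma has_field_derivative_ee [derivative_intros]:
  "(f has_field_derivative d) (at z within S) \<Longrightarrow>
     ((\<lambda>z. ee (f z)) has_field_derivative (2 * of_real pi * \<i> * d * ee (f z))) (at z within S)"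
  unfolding ee_def by (auto intro!: derivative_eq_intros)

text \<open>
  The analytic continuation of the polylogarithm from the unit disc to \<open>Re w < 1\<close>; the values
  elsewhere are arbitrary for \<open>n > 0\<close>.
\<close>

primrec polylog :: "nat \<Rightarrow> complex \<Rightarrow> complex" where
  "polylog 0 = (\<lambda>w. w / (1 - w))"
| "polylog (Suc n) = (SOME g. g 0 = 0 \<and> (\<forall>w. Re w < 1 \<longrightarrow>
     (g has_field_derivative (if w = 0 then 1 else polylog n w / w)) (at w)))"

text \<open>The quotient \<open>polylog n w / w\<close> has a removable singularity at 0, filled by
  the derivative 1 of \<open>polylog n\<close>, and convexity of the half-plane supplies a
  primitive. So the choice in the definition is satisfiable, provided value and derivative at 0 are
  carried through the recursion.\<close>

lemma polylog_Suc_aux: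
  assumes "polylog n holomorphic_on {w. Re w < 1}" "polylog n 0 = 0" "deriv (polylog n) 0 = 1"
  shows "polylog (Suc n) 0 = 0 \<and> (\<forall>w. Re w < 1 \<longrightarrow>
     (polylog (Suc n) has_field_derivative (if w = 0 then 1 else polylog n w / w)) (at w))"
proof -
  let ?S = "{w::complex. Re w < 1}"
  have S: "convex ?S" "open ?S"
    by (simp_all add: convex_halfspace_Re_lt open_halfspace_Re_lt)
  have hol: "(\<lambda>w. if w = 0 then 1 else polylog n w / w) holomorphic_on ?S"
    using pole_lemma_open[OF assms(1) S(2), of 0] unfolding assms(2,3) diff_zero .
  obtain g where g: "\<And>w. w \<in> ?S \<Longrightarrow>
      (g has_field_derivative (if w = 0 then 1 else polylog n w / w)) (at w within ?S)"
    using holomorphic_convex_primitive'[OF S hol] by blast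
  have "\<exists>g. g 0 = 0 \<and> (\<forall>w. Re w < 1 \<longrightarrow>
     (g has_field_derivative (if w = 0 then 1 else polylog n w / w)) (at w))"
  proof (intro exI[of _ "\<lambda>w. g w - g 0"] conjI allI impI)
    fix w :: complex assume w: "Re w < 1"
    hence "(g has_field_derivative (if w = 0 then 1 else polylog n w / w)) (at w)"
      using g[of w] at_within_open[OF _ S(2), of w] by simp
    from DERIV_diff[OF this DERIV_const]
    show "((\<lambda>w. g w - g 0) has_field_derivative (if w = 0 then 1 else polylog n w / w)) (at w)"
      by (simp only: diff_zero)
  qed auto
  from someI_ex[OF this] show ?thesis unfolding polylog.simps .
qed

lemma polylog_aux:
  "polylog n holomorphic_on {w. Re w < 1} \<and> polylog n 0 = 0 \<and> deriv (polylog n) 0 = 1"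
proof (induction n)
  case 0
  have "((\<lambda>w::complex. w / (1 - w)) has_field_derivative 1) (at 0)"
    by (auto intro!: derivative_eq_intros)
  moreover have "(\<lambda>w::complex. w / (1 - w)) holomorphic_on {w. Re w < 1}"
    by (auto intro!: holomorphic_intros)
  ultimately show ?case by (simp add: DERIV_imp_deriv)
next
  case (Suc n)
  from polylog_Suc_aux[of n] Suc
  have *: "polylog (Suc n) 0 = 0" "\<And>w. Re w < 1 \<Longrightarrow>
     (polylog (Suc n) has_field_derivative (if w = 0 then 1 else polylog n w / w)) (at w)"
    by blast+
  have "polylog (Suc n) holomorphic_on {w. Re w < 1}"
    using *(2) by (subst holomorphic_on_open) (auto simp: open_halfspace_Re_lt simp del: polylog.simps)
  with *(1) DERIV_imp_deriv[OF *(2)[of 0]] show ?case by simp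
qed

lemma polylog_0_right [simp]: "polylog n 0 = 0"
  using polylog_aux by blast

lemma polylog_holomorphic: "polylog n holomorphic_on {w. Re w < 1}"
  using polylog_aux by blast

lemma has_field_derivative_polylog:
  "Re w < 1 \<Longrightarrow>
    (polylog (Suc n) has_field_derivative (if w = 0 then 1 else polylog n w / w)) (at w)"
  by (rule polylog_Suc_aux[OF conjunct1[OF polylog_aux] conjunct1[OF conjunct2[OF polylog_aux]]
        conjunct2[OF conjunct2[OF polylog_aux]], THEN conjunct2, rule_format])

declare polylog.simps(2) [simp del]

lemma continuous_on_polylog: "continuous_on {w. Re w < 1} (polylog n)"
  by (rule holomorphic_on_imp_continuous_on[OF polylog_holomorphic])

text \<open>The factor \<open>ee z\<close> from the chain rule cancels the division by
  \<open>w\<close>.\<close>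

lemma has_field_derivative_polylog_ee:
  assumes "Re (ee z) < 1"
  shows "((\<lambda>z. polylog (Suc n) (ee z)) has_field_derivative
           2 * of_real pi * \<i> * polylog n (ee z)) (at z)"
proof -
  have "((\<lambda>z. ee z) has_field_derivative 2 * of_real pi * \<i> * ee z) (at z)"
    by (auto intro!: derivative_eq_intros)
  from DERIV_chain2[OF has_field_derivative_polylog this, of n] assms show ?thesis
    by (simp add: mult_ac)
qed

text \<open>The constant \<open>- 1\<close> is what shifts \<open>E1_sum\<close> by 1 per period,
  and what the monomial in \<open>head_reflected\<close> compensates at order 1.\<close>

lemma polylog_0_ee_minus:
  assumes "ee z \<noteq> 1"
  shows "polylog 0 (ee (- z)) = - 1 - polylog 0 (ee z)"
  using assms by (simp add: ee_minus divide_simps)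

section \<open>Power series with bounded coefficients and power weights\<close>

text \<open>Covers both polylogarithms (\<open>c\<close> constantly 1) and Lambert series. The
  exponent is an integer so that one differentiation rule serves subscripts of either sign.\<close>

definition weighted_polylog :: "(nat \<Rightarrow> complex) \<Rightarrow> int \<Rightarrow> complex \<Rightarrow> complex" where
  "weighted_polylog c k w = (\<Sum>j. c j * of_nat (Suc j) powi k * w ^ Suc j)"

lemma summable_power_geometric:
  fixes r :: real
  assumes "0 \<le> r" "r < 1"
  shows "summable (\<lambda>j. real (Suc j) ^ p * r ^ j)"
  using assms
proof (induction p arbitrary: r)
  case 0
  thus ?case by (simp add: summable_geometric)
next
  case (Suc p)
  have "summable (\<lambda>j. diffs (\<lambda>j. real (Suc j) ^ p) j * r ^ j)"
  proof (rule termdiff_converges[of r 1])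
    fix x :: real assume "norm x < 1"
    hence "summable (\<lambda>j. real (Suc j) ^ p * \<bar>x\<bar> ^ j)" by (intro Suc.IH) auto
    thus "summable (\<lambda>j. real (Suc j) ^ p * x ^ j)"
      by (rule summable_comparison_test'[of _ 0]) (auto simp: abs_mult power_abs)
  qed (use Suc.prems in auto)
  thus ?case
  proof (rule summable_comparison_test'[of _ 0])
    fix j :: nat
    have "real (Suc j) ^ p \<le> real (Suc (Suc j)) ^ p" by (intro power_mono) auto
    thus "norm (real (Suc j) ^ Suc p * r ^ j) \<le> diffs (\<lambda>j. real (Suc j) ^ p) j * r ^ j"
      using Suc.prems by (auto simp: diffs_def abs_mult intro!: mult_mono)
  qed
qed

lemma norm_of_nat_powi_le: "norm (of_nat (Suc j) powi k :: complex) \<le> real (Suc j) ^ nat \<bar>k\<bar>"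
proof (cases "k \<ge> 0")
  case True
  thus ?thesis by (simp add: power_int_def norm_power del: of_nat_Suc)
next
  case False
  have "inverse (real (Suc j) ^ m) \<le> real (Suc j) ^ m" for m
    by (rule order_trans[of _ 1]) (auto simp: field_simps one_le_power)
  with False show ?thesis
    by (simp add: power_int_def norm_power norm_inverse power_inverse del: of_nat_Suc)
qed

lemma weighted_polylog_summable:
  fixes c :: "nat \<Rightarrow> complex"
  assumes c: "\<And>j. norm (c j) \<le> C" and w: "norm w < 1"
  shows "summable (\<lambda>j. norm (c j * of_nat (Suc j) powi k * w ^ j))"
proof (rule summable_comparison_test'[of "\<lambda>j. C * (real (Suc j) ^ nat \<bar>k\<bar> * norm w ^ j)" 0])
  show "summable (\<lambda>j. C * (real (Suc j) ^ nat \<bar>k\<bar> * norm w ^ j))"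
    by (intro summable_mult summable_power_geometric) (use w in auto)
  have "C \<ge> 0" using c[of 0] norm_ge_zero order_trans by blast
  hence "norm (c j) * (norm (of_nat (Suc j) powi k :: complex) * norm w ^ j) \<le>
      C * (real (Suc j) ^ nat \<bar>k\<bar> * norm w ^ j)" for j
    by (intro mult_mono c norm_of_nat_powi_le) auto
  thus "norm (norm (c j * of_nat (Suc j) powi k * w ^ j)) \<le>
      C * (real (Suc j) ^ nat \<bar>k\<bar> * norm w ^ j)" for j
    unfolding real_norm_def abs_norm_cancel unfolding norm_mult norm_power mult.assoc .
qed

lemma weighted_polylog_sums:
  assumes c: "\<And>j. norm (c j) \<le> C" and w: "norm w < 1"
  shows "(\<lambda>j. c j * of_nat (Suc j) powi k * w ^ Suc j) sums weighted_polylog c k w"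
proof -
  have "summable (\<lambda>j. c j * of_nat (Suc j) powi k * w ^ j)"
    by (rule summable_norm_cancel) (rule weighted_polylog_summable[OF c w])
  from summable_mult[OF this, of w] show ?thesis
    unfolding weighted_polylog_def by (intro summable_sums) (simp add: mult_ac)
qed

lemma weighted_polylog_0_right [simp]: "weighted_polylog c k 0 = 0"
  by (simp add: weighted_polylog_def)

text \<open>The operator \<open>w d/dw\<close> multiplies the coefficient of
  \<open>w ^ Suc j\<close> by \<open>Suc j\<close>, which raises \<open>k\<close> by one.\<close>

lemma has_field_derivative_weighted_polylog:
  assumes c: "\<And>j. norm (c j) \<le> C" and w: "norm w < 1"
  shows "(weighted_polylog c k has_field_derivative (if w = 0 then c 0 else weighted_polylog c (k + 1) w / w)) (at w)"
proof -
  \<comment> \<open>A zero constant term is prepended, since the differentiation theorem expects a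
    series starting at exponent 0.\<close>
  define a where "a = (\<lambda>j. case j of 0 \<Rightarrow> 0 | Suc j \<Rightarrow> c j * of_nat (Suc j) powi k)"
  have sa: "summable (\<lambda>j. a j * x ^ j)" if "norm x < 1" for x
    by (rule iffD1[OF summable_Suc_iff])
       (use weighted_polylog_sums[OF c that, where k = k] in \<open>simp add: a_def sums_iff\<close>)
  have eq: "weighted_polylog c k = (\<lambda>x. \<Sum>j. c j * of_nat (Suc j) powi k * x ^ Suc j)"
    by (simp add: fun_eq_iff weighted_polylog_def)
  have "(\<Sum>j. a j * x ^ j) = weighted_polylog c k x" if "norm x < 1" for x
    using suminf_split_head[OF sa[OF that]] by (simp add: weighted_polylog_def a_def)
  hence ev: "eventually (\<lambda>x. (\<Sum>j. a j * x ^ j) = weighted_polylog c k x) (nhds w)"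
    using eventually_nhds_in_open[of "ball 0 1" w] w by (auto elim!: eventually_mono)
  have "((\<lambda>x. \<Sum>j. a j * x ^ j) has_field_derivative (\<Sum>j. diffs a j * w ^ j)) (at w)"
    by (rule termdiffs_strong'[of 1]) (use sa w in auto)
  hence D: "(weighted_polylog c k has_field_derivative (\<Sum>j. diffs a j * w ^ j)) (at w)"
    by (subst (asm) DERIV_cong_ev[OF refl ev refl])
  have "diffs a j = c j * of_nat (Suc j) powi (k + 1)" for j
    by (simp add: diffs_def a_def power_int_add del: of_nat_Suc)
  hence E: "(\<Sum>j. diffs a j * w ^ j) = (\<Sum>j. c j * of_nat (Suc j) powi (k + 1) * w ^ j)" by simp
  show ?thesis
  proof (cases "w = 0")
    case True
    thus ?thesis using D E by (simp add: powser_zero)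
  next
    case False
    have "weighted_polylog c (k + 1) w = (\<Sum>j. c j * of_nat (Suc j) powi (k + 1) * w ^ j * w)"
      by (simp add: weighted_polylog_def mult_ac)
    also have "\<dots> = (\<Sum>j. c j * of_nat (Suc j) powi (k + 1) * w ^ j) * w"
      by (rule suminf_mult2[symmetric]) (rule summable_norm_cancel, rule weighted_polylog_summable[OF c w])
    finally show ?thesis using D E False by simp
  qed
qed

lemma has_field_derivative_weighted_polylog_ee:
  assumes c: "\<And>j. norm (c j) \<le> C" and z: "Im z > 0"
  shows "((\<lambda>z. weighted_polylog c k (ee z)) has_field_derivative 2 * of_real pi * \<i> * weighted_polylog c (k + 1) (ee z)) (at z)"
proof -
  have "((\<lambda>z. ee z) has_field_derivative 2 * of_real pi * \<i> * ee z) (at z)"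
    by (auto intro!: derivative_eq_intros)
  from DERIV_chain2[OF has_field_derivative_weighted_polylog[OF c] this] z show ?thesis
    by (simp add: mult_ac norm_ee_less_1_iff)
qed

lemma int_Suc_uminus: "- int (Suc n) + 1 = - int n"
  by simp

text \<open>By induction both sides have the same derivative on the disc, and both vanish at
  0.\<close>

lemma polylog_eq_weighted_polylog:
  assumes "norm w < 1"
  shows "polylog n w = weighted_polylog (\<lambda>_. 1) (- int n) w"
  using assms
proof (induction n arbitrary: w)
  case 0
  have "(\<lambda>j. w * w ^ j) sums (w * (1 / (1 - w)))"
    by (intro sums_mult geometric_sums 0)
  thus ?case by (simp add: weighted_polylog_def sums_iff)
next
  case (Suc n)
  let ?h = "\<lambda>w. polylog (Suc n) w - weighted_polylog (\<lambda>_. 1) (- int (Suc n)) w"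
  have "(?h has_field_derivative 0) (at x within ball 0 1)" if "x \<in> ball 0 1" for x
  proof -
    from that have x: "norm x < 1" by simp
    hence "Re x < 1" using complex_Re_le_cmod le_less_trans by blast
    from DERIV_diff[OF has_field_derivative_polylog[OF this]
        has_field_derivative_weighted_polylog[where C = 1, OF _ x], of "\<lambda>_. 1" n "- int (Suc n)"]
    have "(?h has_field_derivative 0) (at x)"
      unfolding int_Suc_uminus Suc.IH[OF x] diff_self by simp
    thus ?thesis by (rule has_field_derivative_at_within)
  qed
  hence "\<exists>c. \<forall>x\<in>ball 0 1. ?h x = c"
    by (intro has_field_derivative_zero_constant) auto
  then obtain c where c: "?h x = c" if "norm x < 1" for x by (auto simp: dist_norm)
  from c[of 0] have "c = 0" by simp
  with c[OF Suc.prems] show ?case by simp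
qed

lemma norm_polylog_le:
  assumes "norm w < 1"
  shows "norm (polylog n w) \<le> norm w / (1 - norm w)"
proof -
  have g: "(\<lambda>j. norm w * norm w ^ j) sums (norm w * (1 / (1 - norm w)))"
    by (intro sums_mult geometric_sums) (use assms in auto)
  have "norm (weighted_polylog (\<lambda>_. 1) (- int n) w) \<le> (\<Sum>j. norm w * norm w ^ j)"
    unfolding weighted_polylog_def
  proof (rule norm_suminf_le)
    show "norm (1 * of_nat (Suc j) powi (- int n) * w ^ Suc j) \<le> norm w * norm w ^ j" for j
    proof -
      have "inverse (real (Suc j) ^ n) \<le> 1" by (auto simp: field_simps one_le_power)
      thus ?thesis
        using mult_right_mono[of "inverse (real (Suc j) ^ n)" 1 "norm w ^ Suc j"]
        by (simp add: norm_mult norm_power power_int_minus norm_inverse del: of_nat_Suc)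
    qed
  qed (use g in \<open>auto simp: sums_iff\<close>)
  thus ?thesis using g by (simp add: polylog_eq_weighted_polylog[OF assms] sums_iff)
qed

section \<open>The polylogarithm series on the unit circle\<close>

text \<open>
  Multiplication by \<open>1 - u\<close> turns the conditionally convergent series of order \<open>1\<close> on the
  unit circle into an absolutely convergent one.
\<close>

lemma polylog_1_partial_sum:
  fixes u :: complex
  shows "(1 - u) * (\<Sum>i<Suc N. u ^ Suc i / of_nat (Suc i)) =
    u - u ^ (N + 2) / of_nat (Suc N) - (\<Sum>i<N. u ^ (i + 2) / (of_nat (Suc i) * of_nat (i + 2)))"
proof (induction N)
  case 0
  show ?case by (simp add: algebra_simps)
next
  case (Suc N)
  have nz: "of_nat (Suc N) \<noteq> (0::complex)" "of_nat (N + 2) \<noteq> (0::complex)"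
    unfolding of_nat_eq_0_iff by auto
  have 1: "of_nat (N + 2) = of_nat (Suc N) + (1::complex)" by simp
  have "(1 - u) * (u ^ (N + 2) / of_nat (N + 2)) = u ^ (N + 2) / of_nat (Suc N)
      - u ^ (N + 3) / of_nat (N + 2) - u ^ (N + 2) / (of_nat (Suc N) * of_nat (N + 2))"
    using nz unfolding 1
    by (simp add: divide_simps del: of_nat_Suc) (simp add: algebra_simps power_add numeral_eq_Suc)
  with Suc.IH show ?case
    by (simp add: ring_distribs numeral_eq_Suc del: of_nat_Suc)
qed

lemma continuous_on_power_series_cball:
  fixes c :: "nat \<Rightarrow> complex"
  assumes "summable (\<lambda>j. norm (c j))"
  shows "continuous_on (cball 0 1) (\<lambda>u. \<Sum>j. c j * u ^ e j)"
    and "u \<in> cball 0 1 \<Longrightarrow> summable (\<lambda>j. c j * u ^ e j)"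
proof -
  have le: "norm (c j * u ^ e j) \<le> norm (c j)" if "u \<in> cball 0 1" for j u
    using that by (auto simp: norm_mult norm_power power_le_one intro: mult_left_le)
  have "uniform_limit (cball 0 1) (\<lambda>n u. \<Sum>j<n. c j * u ^ e j) (\<lambda>u. \<Sum>j. c j * u ^ e j) sequentially"
    by (rule Weierstrass_m_test[OF le assms])
  thus "continuous_on (cball 0 1) (\<lambda>u. \<Sum>j. c j * u ^ e j)"
    by (rule uniform_limit_theorem[rotated]) (auto intro!: always_eventually continuous_intros)
  show "u \<in> cball 0 1 \<Longrightarrow> summable (\<lambda>j. c j * u ^ e j)"
    using summable_comparison_test'[OF assms, of 0 "\<lambda>j. c j * u ^ e j"] le by blast
qed

lemma summable_inverse_Suc_power:
  assumes "n \<ge> 2"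
  shows "summable (\<lambda>j. norm (inverse (of_nat (Suc j) ^ n) :: complex))"
proof -
  have "summable (\<lambda>j. inverse (real j ^ n))"
    by (rule inverse_power_summable[OF assms])
  hence "summable (\<lambda>j. inverse (real (Suc j) ^ n))"
    by (subst summable_Suc_iff)
  thus ?thesis by (simp add: norm_inverse norm_power del: of_nat_Suc)
qed

text \<open>Abel's argument: the series has a continuous sum on the closed disc without 1 and equals
  \<open>polylog\<close> inside the disc. Since \<open>polylog\<close> is continuous there as well,
  they agree on the circle.\<close>

lemma polylog_sums_closed_disc:
  assumes n: "n \<ge> 1" and u: "norm u \<le> 1" "u \<noteq> 1"
  shows "(\<lambda>j. u ^ Suc j / of_nat (Suc j) ^ n) sums polylog n u"
proof -
  let ?D = "cball 0 1 - {1 :: complex}"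
  have "\<exists>s. continuous_on ?D s \<and> (\<forall>u\<in>?D. (\<lambda>j. u ^ Suc j / of_nat (Suc j) ^ n) sums s u)"
  proof (cases "n = 1")
    case False
    with n have n2: "n \<ge> 2" by simp
    note C = continuous_on_power_series_cball[OF summable_inverse_Suc_power[OF n2], where e = Suc]
    show ?thesis
      by (intro exI[of _ "\<lambda>u. \<Sum>j. inverse (of_nat (Suc j) ^ n) * u ^ Suc j"] conjI ballI
            continuous_on_subset[OF C(1)])
         (use summable_sums[OF C(2)] in \<open>auto simp: field_simps simp del: of_nat_Suc power_Suc\<close>)
  next
    case True
    \<comment> \<open>The coefficients left after multiplication by \<open>1 - u\<close>, dominated
      by inverse squares.\<close>
    define c :: "nat \<Rightarrow> complex" where "c i = inverse (of_nat (Suc i) * of_nat (i + 2))" for i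
    have "summable (\<lambda>i. norm (c i))"
    proof (rule summable_comparison_test'[OF summable_inverse_Suc_power[of 2], of 0])
      show "norm (norm (c i)) \<le> norm (inverse (of_nat (Suc i) ^ 2) :: complex)" for i
        by (auto simp: c_def norm_mult norm_inverse norm_power power2_eq_square
             simp del: of_nat_Suc of_nat_add intro!: le_imp_inverse_le mult_left_mono)
    qed simp
    note C = continuous_on_power_series_cball[OF this, where e = "\<lambda>i. i + 2"]
    have "(\<lambda>j. u ^ Suc j / of_nat (Suc j) ^ n) sums ((u - (\<Sum>i. c i * u ^ (i + 2))) / (1 - u))"
      if u: "u \<in> ?D" for u
    proof -
      have "(\<lambda>N. (u - u ^ (N + 2) / of_nat (Suc N) - (\<Sum>i<N. c i * u ^ (i + 2))) / (1 - u))
         \<longlonglongrightarrow> (u - 0 - (\<Sum>i. c i * u ^ (i + 2))) / (1 - u)"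
      proof (intro tendsto_intros summable_LIMSEQ C(2))
        have "(\<lambda>N. 1 / real (Suc N)) \<longlonglongrightarrow> 0"
          using LIMSEQ_inverse_real_of_nat by (simp add: divide_inverse)
        thus "(\<lambda>N. u ^ (N + 2) / of_nat (Suc N)) \<longlonglongrightarrow> 0"
        proof (rule Lim_null_comparison[rotated], intro always_eventually allI)
          fix N
          have "norm u ^ (N + 2) \<le> 1" using u by (intro power_le_one) auto
          thus "norm (u ^ (N + 2) / of_nat (Suc N)) \<le> 1 / real (Suc N)"
            by (simp add: norm_divide norm_power divide_right_mono del: of_nat_Suc power_Suc)
        qed
      qed (use u in auto)
      also have "(\<lambda>N. (u - u ^ (N + 2) / of_nat (Suc N) - (\<Sum>i<N. c i * u ^ (i + 2))) / (1 - u)) =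
          (\<lambda>N. \<Sum>i<Suc N. u ^ Suc i / of_nat (Suc i))"
      proof
        fix N
        have "(\<Sum>i<N. c i * u ^ (i + 2)) = (\<Sum>i<N. u ^ (i + 2) / (of_nat (Suc i) * of_nat (i + 2)))"
          by (intro sum.cong) (auto simp: c_def field_simps)
        with polylog_1_partial_sum[of u N] u
        show "(u - u ^ (N + 2) / of_nat (Suc N) - (\<Sum>i<N. c i * u ^ (i + 2))) / (1 - u) =
            (\<Sum>i<Suc N. u ^ Suc i / of_nat (Suc i))"
          by (metis DiffD2 eq_iff_diff_eq_0 insertI1 nonzero_mult_div_cancel_left)
      qed
      finally have "(\<lambda>N. \<Sum>i<N. u ^ Suc i / of_nat (Suc i)) \<longlonglongrightarrow> (u - (\<Sum>i. c i * u ^ (i + 2))) / (1 - u)"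
        by (subst (asm) filterlim_sequentially_Suc) simp
      thus ?thesis unfolding sums_def using True by simp
    qed
    moreover have "continuous_on ?D (\<lambda>u. (u - (\<Sum>i. c i * u ^ (i + 2))) / (1 - u))"
      by (intro continuous_intros continuous_on_subset[OF C(1)]) auto
    ultimately show ?thesis by blast
  qed
  then obtain s where s: "continuous_on ?D s"
    "\<And>u. u \<in> ?D \<Longrightarrow> (\<lambda>j. u ^ Suc j / of_nat (Suc j) ^ n) sums s u" by blast
  \<comment> \<open>A radial approach to \<open>u\<close> from inside the disc.\<close>
  define t :: "nat \<Rightarrow> complex" where "t m = of_real (1 - inverse (real (Suc m))) * u" for m
  have "t \<longlonglongrightarrow> of_real (1 - 0) * u"
    unfolding t_def by (intro tendsto_intros LIMSEQ_inverse_real_of_nat)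
  hence t: "t \<longlonglongrightarrow> u" by simp
  have t1: "norm (t m) < 1" for m
  proof -
    have "norm (t m) = (1 - inverse (real (Suc m))) * norm u"
      unfolding t_def norm_mult norm_of_real by (simp add: field_simps)
    also have "\<dots> \<le> (1 - inverse (real (Suc m))) * 1"
      using u(1) by (intro mult_left_mono) (auto simp: field_simps)
    also have "\<dots> < 1" by simp
    finally show ?thesis .
  qed
  have tD: "t m \<in> ?D" for m using t1[of m] by auto
  have uD: "u \<in> ?D" using u by auto
  have "s (t m) = polylog n (t m)" for m
    using s(2)[OF tD[of m]] weighted_polylog_sums[of "\<lambda>_. 1" 1 "t m" "- int n"] t1[of m]
    by (simp add: polylog_eq_weighted_polylog power_int_minus field_simps sums_iff del: of_nat_Suc power_Suc)
  moreover have "(\<lambda>m. s (t m)) \<longlonglongrightarrow> s u"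
    by (rule continuous_on_tendsto_compose[OF s(1) t uD]) (simp only: tD eventually_True)
  moreover have "(\<lambda>m. polylog n (t m)) \<longlonglongrightarrow> polylog n u"
    by (rule continuous_on_tendsto_compose[OF continuous_on_polylog t])
       (simp_all add: Re_less_1_if_norm_le_1 u tD[unfolded Diff_iff mem_cball_0 singleton_iff])
  ultimately have "s u = polylog n u" using LIMSEQ_unique by simp
  with s(2)[OF uD] show ?thesis by simp
qed

section \<open>Lambert series\<close>

text \<open>In the open strip the positive indices of \<open>E_series k\<close> sum to
  \<open>lambert \<tau> (k - 1) (ee z)\<close> and the negative ones to the same series at
  \<open>\<tau> - z\<close>, up to sign.\<close>

definition lambert :: "complex \<Rightarrow> int \<Rightarrow> complex \<Rightarrow> complex" where
  "lambert \<tau> = weighted_polylog (\<lambda>j. 1 / (1 - ee \<tau> ^ Suc j))"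

lemma norm_lambert_coeff_le:
  assumes "Im \<tau> > 0"
  shows "norm (1 / (1 - ee \<tau> ^ Suc j)) \<le> 1 / (1 - norm (ee \<tau>))"
proof -
  have q: "norm (ee \<tau>) < 1" using assms by (simp add: norm_ee_less_1_iff)
  have "norm (ee \<tau> ^ Suc j) \<le> norm (ee \<tau>)"
    using q power_decreasing[of 1 "Suc j" "norm (ee \<tau>)"] by (simp add: norm_power del: power_Suc)
  moreover have "norm (1::complex) - norm (ee \<tau> ^ Suc j) \<le> norm (1 - ee \<tau> ^ Suc j)"
    by (rule norm_triangle_ineq2)
  ultimately have "1 - norm (ee \<tau>) \<le> norm (1 - ee \<tau> ^ Suc j)" by simp
  with q show ?thesis by (simp add: norm_divide frac_le del: power_Suc)
qed

lemma ee_power_neq_1: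
  assumes "Im \<tau> > 0"
  shows "ee \<tau> ^ Suc j \<noteq> 1"
proof
  assume "ee \<tau> ^ Suc j = 1"
  hence "norm (ee \<tau>) ^ Suc j = 1" by (metis norm_one norm_power)
  moreover have "norm (ee \<tau>) < 1" using assms by (simp add: norm_ee_less_1_iff)
  ultimately show False by (simp add: power_Suc_less_one[THEN less_imp_neq] del: power_Suc)
qed

lemma lambert_sums:
  assumes "Im \<tau> > 0" "norm w < 1"
  shows "(\<lambda>j. 1 / (1 - ee \<tau> ^ Suc j) * of_nat (Suc j) powi k * w ^ Suc j) sums lambert \<tau> k w"
  unfolding lambert_def by (rule weighted_polylog_sums[OF norm_lambert_coeff_le[OF assms(1)] assms(2)])

lemma has_field_derivative_lambert_ee:
  assumes "Im \<tau> > 0" "Im z > 0"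
  shows "((\<lambda>z. lambert \<tau> k (ee z)) has_field_derivative
           2 * of_real pi * \<i> * lambert \<tau> (k + 1) (ee z)) (at z)"
  unfolding lambert_def
  by (rule has_field_derivative_weighted_polylog_ee[OF norm_lambert_coeff_le[OF assms(1)] assms(2)])

text \<open>The identity \<open>1 / (1 - p) = 1 + p / (1 - p)\<close> splits off a polylogarithm and
  moves the rest to \<open>w * ee \<tau>\<close>, which is inside the disc even if
  \<open>norm w = 1\<close>. So only the polylogarithm meets the unit circle.\<close>

lemma lambert_sums_closed_disc:
  assumes \<tau>: "Im \<tau> > 0" and w: "norm w < 1 \<or> n \<ge> 1 \<and> norm w \<le> 1 \<and> w \<noteq> 1"
  shows "(\<lambda>j. 1 / (1 - ee \<tau> ^ Suc j) * of_nat (Suc j) powi (- int n) * w ^ Suc j) sums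
    (polylog n w + lambert \<tau> (- int n) (w * ee \<tau>))"
proof -
  have "norm (ee \<tau>) < 1" using \<tau> by (simp add: norm_ee_less_1_iff)
  moreover have "norm w * norm (ee \<tau>) \<le> 1 * norm (ee \<tau>)"
    using w by (intro mult_right_mono) auto
  ultimately have wq: "norm (w * ee \<tau>) < 1" unfolding norm_mult by linarith
  have "(\<lambda>j. 1 * of_nat (Suc j) powi (- int n) * w ^ Suc j) sums polylog n w"
  proof (cases "norm w < 1")
    case True
    show ?thesis using weighted_polylog_sums[of "\<lambda>_. 1" 1 w "- int n"] True by (simp add: polylog_eq_weighted_polylog)
  next
    case False
    with w have "n \<ge> 1" "norm w \<le> 1" "w \<noteq> 1" by auto
    from polylog_sums_closed_disc[OF this] show ?thesis
      by (simp add: power_int_minus field_simps del: of_nat_Suc power_Suc)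
  qed
  from sums_add[OF this lambert_sums[OF \<tau> wq, of "- int n"]]
  have "(\<lambda>j. 1 * of_nat (Suc j) powi (- int n) * w ^ Suc j + 1 / (1 - ee \<tau> ^ Suc j) *
      of_nat (Suc j) powi (- int n) * (w * ee \<tau>) ^ Suc j) sums
      (polylog n w + lambert \<tau> (- int n) (w * ee \<tau>))" .
  also have "(\<lambda>j. 1 * of_nat (Suc j) powi (- int n) * w ^ Suc j + 1 / (1 - ee \<tau> ^ Suc j) *
      of_nat (Suc j) powi (- int n) * (w * ee \<tau>) ^ Suc j) =
      (\<lambda>j. 1 / (1 - ee \<tau> ^ Suc j) * of_nat (Suc j) powi (- int n) * w ^ Suc j)"
  proof
    fix j
    define p where "p = ee \<tau> ^ Suc j"
    have "1 + 1 / (1 - p) * p = 1 / (1 - p)"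
      using ee_power_neq_1[OF \<tau>, of j] by (simp add: p_def divide_simps del: power_Suc)
    hence "(1 + 1 / (1 - p) * p) * of_nat (Suc j) powi (- int n) * w ^ Suc j =
        1 / (1 - p) * of_nat (Suc j) powi (- int n) * w ^ Suc j" by (simp only:)
    thus "1 * of_nat (Suc j) powi (- int n) * w ^ Suc j + 1 / (1 - ee \<tau> ^ Suc j) *
      of_nat (Suc j) powi (- int n) * (w * ee \<tau>) ^ Suc j =
      1 / (1 - ee \<tau> ^ Suc j) * of_nat (Suc j) powi (- int n) * w ^ Suc j"
      unfolding p_def[symmetric] power_mult_distrib by (simp only: ring_distribs mult_1_left mult_ac)
  qed
  finally show ?thesis .
qed

lemma lambert_rec:
  assumes "Im \<tau> > 0" "Im z > 0"
  shows "lambert \<tau> (- int n) (ee z) = polylog n (ee z) + lambert \<tau> (- int n) (ee (z + \<tau>))"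
  using lambert_sums[OF assms(1), of "ee z" "- int n"]
    lambert_sums_closed_disc[OF assms(1), of "ee z" n] assms(2)
  by (simp add: norm_ee_less_1_iff ee_add sums_iff)

section \<open>The nonholomorphic part\<close>

text \<open>
  The sum of the terms \<open>\<Gamma>\<^sup>*(n, 4 \<pi> m Im w) / m\<^sup>n exp(-2 \<pi> i m w)\<close> over \<open>m\<close>, rewritten in terms
  of \<open>cnj w\<close> so that its derivatives can be read off.
\<close>

definition conj_part :: "nat \<Rightarrow> complex \<Rightarrow> complex" where
  "conj_part n w = (\<Sum>k<n. of_real ((4 * pi * Im w) ^ k / fact k) * polylog (n - k) (cnj (ee w)))"

lemma conj_part_0 [simp]: "conj_part 0 w = 0"
  by (simp add: conj_part_def)

text \<open>Since \<open>- 4 pi m Im w - 2 pi \<i> m w = - 2 pi \<i> m cnj w\<close>, the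
  exponential in \<open>Gamma_star\<close> makes the second factor antiholomorphic and, for
  \<open>Im w > 0\<close>, decaying.\<close>

lemma Gamma_star_exp:
  "of_real (Gamma_star n (4 * pi * real m * Im w)) * exp (- 2 * of_real pi * \<i> * of_nat m * w) =
     (\<Sum>k<n. of_real ((4 * pi * Im w) ^ k / fact k) * (of_nat m ^ k * cnj (ee w) ^ m))"
proof -
  have "complex_of_real (exp (- (4 * pi * real m * Im w))) * exp (- 2 * of_real pi * \<i> * of_nat m * w) =
      exp (- of_real (4 * pi * real m * Im w) + - 2 * of_real pi * \<i> * of_nat m * w)"
    by (simp add: exp_of_real[symmetric] exp_add[symmetric])
  also have "- complex_of_real (4 * pi * real m * Im w) + - 2 * of_real pi * \<i> * of_nat m * w =
      2 * of_real pi * \<i> * (of_nat m * (- cnj w))"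
    by (simp add: complex_eq_iff)
  also have "exp \<dots> = ee (of_nat m * (- cnj w))" by (simp only: ee_def)
  also have "\<dots> = cnj (ee w) ^ m" by (simp only: ee_of_nat_mult cnj_ee)
  finally have *: "complex_of_real (exp (- (4 * pi * real m * Im w))) *
      exp (- 2 * of_real pi * \<i> * of_nat m * w) = cnj (ee w) ^ m" .
  have "of_real (Gamma_star n (4 * pi * real m * Im w)) * exp (- 2 * of_real pi * \<i> * of_nat m * w) =
      (\<Sum>k<n. of_real ((4 * pi * real m * Im w) ^ k / fact k)) * cnj (ee w) ^ m"
    unfolding *[symmetric] Gamma_star_def by simp
  also have "\<dots> = (\<Sum>k<n. of_real ((4 * pi * Im w) ^ k / fact k) * (of_nat m ^ k * cnj (ee w) ^ m))"
    unfolding sum_distrib_right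
    by (intro sum.cong refl) (simp add: power_mult_distrib mult_ac)
  finally show ?thesis .
qed

text \<open>Dividing \<open>m ^ k\<close> by \<open>m ^ n\<close> leaves order \<open>n - k\<close>,
  which is at least 1, so the polylogarithm series also converge for
  \<open>Im w = 0\<close>.\<close>

lemma conj_part_sums:
  assumes "Im w \<ge> 0" "ee w \<noteq> 1"
  shows "(\<lambda>i. of_real (Gamma_star n (4 * pi * real (Suc i) * Im w)) / of_nat (Suc i) powi int n *
           exp (- 2 * of_real pi * \<i> * of_nat (Suc i) * w)) sums conj_part n w"
proof -
  let ?u = "cnj (ee w)"
  have u: "norm ?u \<le> 1" "?u \<noteq> 1"
    using assms by (simp_all add: norm_ee_le_1_iff)
  have "(\<lambda>i. \<Sum>k<n. of_real ((4 * pi * Im w) ^ k / fact k) * (?u ^ Suc i / of_nat (Suc i) ^ (n - k)))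
          sums conj_part n w"
    unfolding conj_part_def
    by (intro sums_sum sums_mult polylog_sums_closed_disc u) auto
  also have "(\<lambda>i. \<Sum>k<n. of_real ((4 * pi * Im w) ^ k / fact k) * (?u ^ Suc i / of_nat (Suc i) ^ (n - k))) =
    (\<lambda>i. of_real (Gamma_star n (4 * pi * real (Suc i) * Im w)) / of_nat (Suc i) powi int n *
           exp (- 2 * of_real pi * \<i> * of_nat (Suc i) * w))"
  proof
    fix i
    have nz: "of_nat (Suc i) \<noteq> (0::complex)" by (simp only: of_nat_eq_0_iff)
    have "(\<Sum>k<n. of_real ((4 * pi * Im w) ^ k / fact k) * (?u ^ Suc i / of_nat (Suc i) ^ (n - k))) =
      (\<Sum>k<n. of_real ((4 * pi * Im w) ^ k / fact k) * (of_nat (Suc i) ^ k * ?u ^ Suc i)) / of_nat (Suc i) ^ n"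
      unfolding sum_divide_distrib
    proof (intro sum.cong refl)
      fix k assume "k \<in> {..<n}"
      hence "of_nat (Suc i) ^ n = (of_nat (Suc i) ^ k * of_nat (Suc i) ^ (n - k) :: complex)"
        unfolding power_add[symmetric] by simp
      thus "of_real ((4 * pi * Im w) ^ k / fact k) * (?u ^ Suc i / of_nat (Suc i) ^ (n - k)) =
        of_real ((4 * pi * Im w) ^ k / fact k) * (of_nat (Suc i) ^ k * ?u ^ Suc i) / of_nat (Suc i) ^ n"
        using nz by (simp add: divide_simps del: of_nat_Suc power_Suc)
    qed
    also have "\<dots> = of_real (Gamma_star n (4 * pi * real (Suc i) * Im w)) / of_nat (Suc i) powi int n *
           exp (- 2 * of_real pi * \<i> * of_nat (Suc i) * w)"
      unfolding Gamma_star_exp[symmetric] by (simp del: of_nat_Suc)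
    finally show "(\<Sum>k<n. of_real ((4 * pi * Im w) ^ k / fact k) * (?u ^ Suc i / of_nat (Suc i) ^ (n - k))) =
      of_real (Gamma_star n (4 * pi * real (Suc i) * Im w)) / of_nat (Suc i) powi int n *
           exp (- 2 * of_real pi * \<i> * of_nat (Suc i) * w)" .
  qed
  finally show ?thesis .
qed

definition conj_part_cnj_deriv :: "nat \<Rightarrow> complex \<Rightarrow> complex" where
  "conj_part_cnj_deriv n w =
     - 2 * of_real pi * \<i> * (of_real ((4 * pi * Im w) ^ n / fact n) * polylog 0 (cnj (ee w)))"

lemma has_wirtinger_power_Im:
  "has_wirtinger (\<lambda>w. of_real ((4 * pi * Im w) ^ Suc k / fact (Suc k)))
     (- 2 * of_real pi * \<i> * of_real ((4 * pi * Im w) ^ k / fact k))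
     (2 * of_real pi * \<i> * of_real ((4 * pi * Im w) ^ k / fact k)) w"
proof -
  have "((\<lambda>y. (4 * pi * y) ^ Suc k / fact (Suc k)) has_real_derivative
      real (Suc k) * (4 * pi) * (4 * pi * Im w) ^ k / fact (Suc k)) (at (Im w))"
    by (auto intro!: derivative_eq_intros simp del: power_Suc of_nat_Suc fact_Suc)
  also have "real (Suc k) * (4 * pi) * (4 * pi * Im w) ^ k / fact (Suc k) =
      4 * pi * ((4 * pi * Im w) ^ k / fact k)"
    by (simp add: divide_simps del: of_nat_Suc)
  finally have "((\<lambda>y. (4 * pi * y) ^ Suc k / fact (Suc k)) has_real_derivative
      4 * pi * ((4 * pi * Im w) ^ k / fact k)) (at (Im w))" .
  from has_wirtinger_Im[OF this] show ?thesis
    by (rule has_wirtinger_eq_rhs) simp_all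
qed

lemma has_wirtinger_polylog_cnj:
  assumes "Re (ee w) < 1"
  shows "has_wirtinger (\<lambda>w. polylog (Suc n) (cnj (ee w))) 0
           (- 2 * of_real pi * \<i> * polylog n (cnj (ee w))) w"
proof -
  have "((\<lambda>u. polylog (Suc n) (ee (- u))) has_field_derivative
      2 * of_real pi * \<i> * polylog n (ee (- cnj w)) * - 1) (at (cnj w))"
    by (rule DERIV_chain2[OF has_field_derivative_polylog_ee])
       (use assms in \<open>auto intro!: derivative_eq_intros simp: cnj_ee[symmetric]\<close>)
  from has_wirtinger_cnj[OF this] show ?thesis
    by (simp add: cnj_ee)
qed

text \<open>The polylogarithms are antiholomorphic, so the derivative by \<open>w\<close> only hits
  the powers of \<open>Im w\<close> and lowers \<open>n\<close>. In the derivative by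
  \<open>cnj w\<close>, the term from a power cancels the one from the polylogarithm beside the
  preceding power; the sum telescopes to its last term.\<close>

lemma has_wirtinger_conj_part:
  assumes "Re (ee w) < 1"
  shows "has_wirtinger (conj_part (Suc n)) (- 2 * of_real pi * \<i> * conj_part n w)
           (conj_part_cnj_deriv n w) w"
proof -
  define p where "p = (\<lambda>k w. complex_of_real ((4 * pi * Im w) ^ k / fact k))"
  define L where "L = (\<lambda>k. polylog k (cnj (ee w)))"
  \<comment> \<open>The exponent 0 is treated apart: its derivative is 0, not a lower power.\<close>
  define p' where "p' = (\<lambda>k. case k of 0 \<Rightarrow> 0 | Suc k \<Rightarrow> 2 * of_real pi * \<i> * p k w)"
  have p: "has_wirtinger (p k) (- p' k) (p' k) w" for k
  proof (cases k)
    case 0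
    have "has_wirtinger (\<lambda>w. 1) 0 0 w" by (simp add: has_wirtinger_def)
    thus ?thesis using 0 by (simp add: p_def p'_def)
  next
    case (Suc j)
    show ?thesis
      using has_wirtinger_power_Im[of j w] unfolding Suc p_def p'_def by simp
  qed
  have L': "has_wirtinger (\<lambda>w. polylog (Suc n - k) (cnj (ee w))) 0 (- 2 * of_real pi * \<i> * L (n - k)) w"
    if "k < Suc n" for k
    using has_wirtinger_polylog_cnj[OF assms, of "n - k"] that by (simp add: L_def Suc_diff_le)
  have "has_wirtinger (\<lambda>w. \<Sum>k<Suc n. p k w * polylog (Suc n - k) (cnj (ee w)))
      (\<Sum>k<Suc n. - p' k * polylog (Suc n - k) (cnj (ee w)) + p k w * 0)
      (\<Sum>k<Suc n. p' k * polylog (Suc n - k) (cnj (ee w)) + p k w * (- 2 * of_real pi * \<i> * L (n - k))) w"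
    by (intro has_wirtinger_sum has_wirtinger_mult p L') auto
  also have "(\<lambda>w. \<Sum>k<Suc n. p k w * polylog (Suc n - k) (cnj (ee w))) = conj_part (Suc n)"
    by (simp add: fun_eq_iff conj_part_def p_def)
  finally show ?thesis
  proof (rule has_wirtinger_eq_rhs)
    show "(\<Sum>k<Suc n. - p' k * polylog (Suc n - k) (cnj (ee w)) + p k w * 0) =
        - 2 * of_real pi * \<i> * conj_part n w"
      by (subst sum.lessThan_Suc_shift)
         (simp add: p'_def conj_part_def p_def sum_distrib_left sum_negf mult_ac)
    have "(\<Sum>k<Suc n. p' k * polylog (Suc n - k) (cnj (ee w)) + p k w * (- 2 * of_real pi * \<i> * L (n - k))) =
       (\<Sum>k<Suc n. p' k * L (Suc n - k) - p' (Suc k) * L (Suc n - Suc k))"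
      by (intro sum.cong) (auto simp: L_def p'_def)
    also have "\<dots> = p' 0 * L (Suc n) - p' (Suc n) * L 0"
      by (subst sum_lessThan_telescope') simp
    also have "\<dots> = conj_part_cnj_deriv n w"
      by (simp add: p'_def p_def L_def conj_part_cnj_deriv_def mult_ac)
    finally show "(\<Sum>k<Suc n. p' k * polylog (Suc n - k) (cnj (ee w)) +
       p k w * (- 2 * of_real pi * \<i> * L (n - k))) = conj_part_cnj_deriv n w" .
  qed
qed

section \<open>Convergence of the sums over translates\<close>

text \<open>After \<open>j + 1\<close> periods \<open>Im w\<close> lies between
  \<open>\<delta> + j * v\<close> and \<open>(R + v) * (j + 1)\<close>: the polylogarithm decays
  geometrically in \<open>j\<close>, the power grows polynomially. The lower edge of the strip may
  approach \<open>- Im \<tau>\<close>, so neighbourhoods of the real line are covered.\<close>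

lemma conj_part_term_bound:
  assumes v: "Im \<tau> > 0" and \<delta>: "\<delta> > 0" and R: "R \<ge> 0"
  obtains M where "summable M"
    "\<And>i j z. \<delta> - Im \<tau> < Im z \<Longrightarrow> Im z < R \<Longrightarrow>
       norm (of_real ((4 * pi * Im (z + of_nat (Suc j) * \<tau>)) ^ k / fact k) *
         polylog i (cnj (ee (z + of_nat (Suc j) * \<tau>)))) \<le> M j"
proof
  define v where "v = Im \<tau>"
  define D where "D = (4 * pi * (R + v)) ^ k / fact k * (exp (- 2 * pi * \<delta>) / (1 - exp (- 2 * pi * \<delta>)))"
  let ?M = "\<lambda>j. D * (real (Suc j) ^ k * exp (- 2 * pi * v) ^ j)"
  have vp: "v > 0" using v by (simp add: v_def)
  show "summable ?M"
    by (intro summable_mult summable_power_geometric) (use vp in auto)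
  fix i j z assume z: "\<delta> - Im \<tau> < Im z" "Im z < R"
  define w where "w = z + of_nat (Suc j) * \<tau>"
  have Imw: "Im w = Im z + real (Suc j) * v" by (simp add: w_def v_def)
  have w1: "Im w \<ge> \<delta> + real j * v" using z by (simp add: Imw v_def algebra_simps)
  have "R \<le> R * real (Suc j)" using R by (simp add: algebra_simps)
  hence w2: "Im w \<le> (R + v) * real (Suc j)" using z by (simp add: Imw algebra_simps del: of_nat_Suc)
  have w0: "Im w > 0" using w1 \<delta> vp by (smt (verit) mult_nonneg_nonneg of_nat_0_le_iff)
  have e1: "norm (ee w) \<le> exp (- 2 * pi * \<delta>) * exp (- 2 * pi * v) ^ j"
  proof -
    have "norm (ee w) \<le> exp (- 2 * pi * (\<delta> + real j * v))"
      using w1 by (simp add: norm_ee)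
    also have "\<dots> = exp (- 2 * pi * \<delta>) * exp (- 2 * pi * v) ^ j"
      by (simp add: exp_of_nat_mult[symmetric] exp_add[symmetric] algebra_simps)
    finally show ?thesis .
  qed
  also have "\<dots> \<le> exp (- 2 * pi * \<delta>) * 1"
    using vp by (intro mult_left_mono power_le_one) auto
  finally have e2: "norm (ee w) \<le> exp (- 2 * pi * \<delta>)" by simp
  have e3: "exp (- 2 * pi * \<delta>) < 1" using \<delta> by simp
  have "norm (polylog i (cnj (ee w))) \<le> norm (ee w) / (1 - norm (ee w))"
    using norm_polylog_le[of "cnj (ee w)" i] e2 e3 by simp
  also have "\<dots> \<le> exp (- 2 * pi * \<delta>) * exp (- 2 * pi * v) ^ j / (1 - exp (- 2 * pi * \<delta>))"
    by (intro frac_le e1) (use e2 e3 in auto)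
  finally have P: "norm (polylog i (cnj (ee w))) \<le> \<dots>" .
  have "norm (complex_of_real ((4 * pi * Im w) ^ k / fact k)) = (4 * pi * Im w) ^ k / fact k"
    unfolding norm_of_real using w0 by simp
  also have "\<dots> \<le> (4 * pi * ((R + v) * real (Suc j))) ^ k / fact k"
    using w0 w2 by (intro divide_right_mono power_mono mult_left_mono) auto
  finally have Q: "norm (complex_of_real ((4 * pi * Im w) ^ k / fact k)) \<le> \<dots>" .
  have "norm (of_real ((4 * pi * Im w) ^ k / fact k) * polylog i (cnj (ee w))) \<le>
     (4 * pi * ((R + v) * real (Suc j))) ^ k / fact k *
     (exp (- 2 * pi * \<delta>) * exp (- 2 * pi * v) ^ j / (1 - exp (- 2 * pi * \<delta>)))"
    unfolding norm_mult by (intro mult_mono P Q) (use R vp in auto)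
  also have "\<dots> = ?M j"
    by (simp add: D_def power_mult_distrib mult_ac
          del: of_nat_Suc distrib_left_numeral distrib_right_numeral)
  finally show "norm (of_real ((4 * pi * Im (z + of_nat (Suc j) * \<tau>)) ^ k / fact k) *
         polylog i (cnj (ee (z + of_nat (Suc j) * \<tau>)))) \<le> ?M j" unfolding w_def .
qed

lemma conj_part_bound:
  assumes v: "Im \<tau> > 0" and \<delta>: "\<delta> > 0" and R: "R \<ge> 0"
  obtains M where "summable M"
    "\<And>j z. \<delta> - Im \<tau> < Im z \<Longrightarrow> Im z < R \<Longrightarrow> norm (conj_part n (z + of_nat (Suc j) * \<tau>)) \<le> M j"
proof -
  have "\<exists>M. summable M \<and> (\<forall>i j z. \<delta> - Im \<tau> < Im z \<longrightarrow> Im z < R \<longrightarrow>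
       norm (of_real ((4 * pi * Im (z + of_nat (Suc j) * \<tau>)) ^ k / fact k) *
         polylog i (cnj (ee (z + of_nat (Suc j) * \<tau>)))) \<le> M j)" for k
    using conj_part_term_bound[OF assms, of k] by metis
  then obtain M where M: "\<And>k. summable (M k)" "\<And>k i j z. \<delta> - Im \<tau> < Im z \<Longrightarrow> Im z < R \<Longrightarrow>
       norm (of_real ((4 * pi * Im (z + of_nat (Suc j) * \<tau>)) ^ k / fact k) *
         polylog i (cnj (ee (z + of_nat (Suc j) * \<tau>)))) \<le> M k j" by metis
  show thesis
  proof (rule that[of "\<lambda>j. \<Sum>k<n. M k j"])
    show "summable (\<lambda>j. \<Sum>k<n. M k j)" by (intro summable_sum M(1))
    show "norm (conj_part n (z + of_nat (Suc j) * \<tau>)) \<le> (\<Sum>k<n. M k j)"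
      if "\<delta> - Im \<tau> < Im z" "Im z < R" for j z
      unfolding conj_part_def by (intro sum_norm_le M(2) that)
  qed
qed

lemma summable_conj_part:
  assumes "Im \<tau> > 0" "Im z > - Im \<tau>"
  shows "summable (\<lambda>j. conj_part n (z + of_nat (Suc j) * \<tau>))"
proof -
  obtain M where M: "summable M" "\<And>j z'. (Im z + Im \<tau>) / 2 - Im \<tau> < Im z' \<Longrightarrow>
      Im z' < \<bar>Im z\<bar> + 1 \<Longrightarrow> norm (conj_part n (z' + of_nat (Suc j) * \<tau>)) \<le> M j"
    by (rule conj_part_bound[OF assms(1), of "(Im z + Im \<tau>) / 2" "\<bar>Im z\<bar> + 1" n]) (use assms in auto)
  show ?thesis
    by (rule summable_comparison_test'[OF M(1), of 0], rule M(2)) (use assms in \<open>auto simp: field_simps\<close>)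
qed

section \<open>Separating the untranslated terms from the translates\<close>

text \<open>The terms at \<open>z\<close> itself, the only ones to reach the unit circle for real
  \<open>z\<close>. The alternating sign offsets the opposite signs with which differentiation acts
  on \<open>polylog\<close> and \<open>conj_part\<close>.\<close>

definition head_part :: "nat \<Rightarrow> complex \<Rightarrow> complex" where
  "head_part n z = polylog n (ee z) + (- 1) ^ Suc n * conj_part n z"

text \<open>The translates by positive multiples of \<open>\<tau>\<close>. They are differentiable
  for \<open>Im z > - Im \<tau>\<close>, hence near the real line both at \<open>z\<close> and at
  \<open>- z\<close>.\<close>

definition tail_part :: "complex \<Rightarrow> nat \<Rightarrow> complex \<Rightarrow> complex" where
  "tail_part \<tau> n z = lambert \<tau> (- int n) (ee (z + \<tau>)) +
     (- 1) ^ Suc n * (\<Sum>j. conj_part n (z + of_nat (Suc j) * \<tau>))"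

lemma has_wirtinger_head_part:
  assumes "Re (ee z) < 1"
  shows "has_wirtinger (head_part (Suc n)) (2 * of_real pi * \<i> * head_part n z)
           ((- 1) ^ n * conj_part_cnj_deriv n z) z"
proof -
  have eq: "head_part (Suc n) = (\<lambda>z. polylog (Suc n) (ee z) + (- 1) ^ n * conj_part (Suc n) z)"
    by (simp add: fun_eq_iff head_part_def)
  have "has_wirtinger (head_part (Suc n))
      (2 * of_real pi * \<i> * polylog n (ee z) + (- 1) ^ n * (- 2 * of_real pi * \<i> * conj_part n z))
      (0 + (- 1) ^ n * conj_part_cnj_deriv n z) z"
    unfolding eq
    by (intro has_wirtinger_add has_wirtinger_cmult has_wirtinger_conj_part has_wirtinger_holomorphic
          has_field_derivative_polylog_ee assms)
  thus ?thesis
    by (rule has_wirtinger_eq_rhs) (simp_all add: head_part_def algebra_simps)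
qed

lemma has_wirtinger_tail_part:
  assumes \<tau>: "Im \<tau> > 0" and z: "Im z > - Im \<tau>"
  obtains B where "has_wirtinger (tail_part \<tau> (Suc n)) (2 * of_real pi * \<i> * tail_part \<tau> n z) B z"
proof -
  \<comment> \<open>Half the distance of \<open>z\<close> from the line
    \<open>Im w = - Im \<tau>\<close>, which leaves room around \<open>z\<close>.\<close>
  define \<delta> R where "\<delta> = (Im z + Im \<tau>) / 2" and "R = \<bar>Im z\<bar> + 1"
  have \<delta>R: "\<delta> > 0" "R \<ge> 0" "\<delta> - Im \<tau> < Im z" "Im z < R"
    using z by (auto simp: \<delta>_def R_def field_simps)
  define S where "S = {w. Im w > \<delta> - Im \<tau>} \<inter> {w. Im w < R}"
  have S: "convex S" "open S" "z \<in> S"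
    unfolding S_def using \<delta>R
    by (auto intro!: convex_Int open_Int convex_halfspace_Im_gt convex_halfspace_Im_lt
          open_halfspace_Im_gt open_halfspace_Im_lt)
  obtain M where M: "summable M" "\<And>j z. \<delta> - Im \<tau> < Im z \<Longrightarrow> Im z < R \<Longrightarrow>
      norm (conj_part n (z + of_nat (Suc j) * \<tau>)) \<le> M j"
    using conj_part_bound[OF \<tau> \<delta>R(1,2), of n] by blast
  obtain M' where M': "summable M'" "\<And>i j z. \<delta> - Im \<tau> < Im z \<Longrightarrow> Im z < R \<Longrightarrow>
       norm (of_real ((4 * pi * Im (z + of_nat (Suc j) * \<tau>)) ^ n / fact n) *
         polylog i (cnj (ee (z + of_nat (Suc j) * \<tau>)))) \<le> M' j"
    using conj_part_term_bound[OF \<tau> \<delta>R(1,2), of n] by blast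
  have nn: "0 \<le> M j" "0 \<le> M' j" for j
    using M(2)[OF \<delta>R(3,4), of j] M'(2)[OF \<delta>R(3,4), of j 0] norm_ge_zero order_trans by blast+
  have Re: "Re (ee (w + of_nat (Suc j) * \<tau>)) < 1" if "w \<in> S" for w j
  proof -
    have "Im w > - Im \<tau>" using that \<delta>R(1) by (auto simp: S_def)
    moreover have "real (Suc j) * Im \<tau> \<ge> Im \<tau>" using \<tau> by (simp add: algebra_simps)
    ultimately have "0 < Im (w + of_nat (Suc j) * \<tau>)" by simp
    thus ?thesis
      using complex_Re_le_cmod le_less_trans norm_ee_less_1_iff by blast
  qed
  have W: "has_wirtinger (\<lambda>w. \<Sum>j. conj_part (Suc n) (w + of_nat (Suc j) * \<tau>))
     (\<Sum>j. - 2 * of_real pi * \<i> * conj_part n (z + of_nat (Suc j) * \<tau>))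
     (\<Sum>j. conj_part_cnj_deriv n (z + of_nat (Suc j) * \<tau>)) z"
  proof (rule has_wirtinger_suminf[OF S, where M = "\<lambda>j. 2 * pi * (M j + M' j)"])
    fix w j assume w: "w \<in> S"
    show "has_wirtinger (\<lambda>w. conj_part (Suc n) (w + of_nat (Suc j) * \<tau>))
        (- 2 * of_real pi * \<i> * conj_part n (w + of_nat (Suc j) * \<tau>))
        (conj_part_cnj_deriv n (w + of_nat (Suc j) * \<tau>)) w"
      by (intro has_wirtinger_shift has_wirtinger_conj_part Re w)
    show "norm (- 2 * of_real pi * \<i> * conj_part n (w + of_nat (Suc j) * \<tau>)) \<le> 2 * pi * (M j + M' j)"
      using M(2)[of w j] nn(2)[of j] w by (simp add: norm_mult S_def del: of_nat_Suc)
    show "norm (conj_part_cnj_deriv n (w + of_nat (Suc j) * \<tau>)) \<le> 2 * pi * (M j + M' j)"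
      using M'(2)[of w j 0] nn(1)[of j] w unfolding conj_part_cnj_deriv_def
      by (subst norm_mult) (simp add: S_def norm_mult del: of_nat_Suc polylog.simps)
  next
    show "summable (\<lambda>j. 2 * pi * (M j + M' j))" by (intro summable_mult summable_add M(1) M'(1))
    show "summable (\<lambda>j. conj_part (Suc n) (w + of_nat (Suc j) * \<tau>))" if "w \<in> S" for w
      by (rule summable_conj_part[OF \<tau>]) (use that \<delta>R(1) in \<open>auto simp: S_def\<close>)
  qed
  have "((\<lambda>z. lambert \<tau> (- int (Suc n)) (ee (z + \<tau>))) has_field_derivative
     2 * of_real pi * \<i> * lambert \<tau> (- int (Suc n) + 1) (ee (z + \<tau>)) * 1) (at z)"
    by (rule DERIV_chain2[OF has_field_derivative_lambert_ee[OF \<tau>]])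
       (use z in \<open>auto intro!: derivative_eq_intros\<close>)
  hence L: "has_wirtinger (\<lambda>z. lambert \<tau> (- int (Suc n)) (ee (z + \<tau>)))
      (2 * of_real pi * \<i> * lambert \<tau> (- int n) (ee (z + \<tau>))) 0 z"
    by (intro has_wirtinger_holomorphic) (simp add: int_Suc_uminus)
  have sum_eq: "(\<Sum>j. - 2 * of_real pi * \<i> * conj_part n (z + of_nat (Suc j) * \<tau>)) =
      - 2 * of_real pi * \<i> * (\<Sum>j. conj_part n (z + of_nat (Suc j) * \<tau>))"
    by (rule suminf_mult[OF summable_conj_part[OF \<tau> z]])
  have eq: "tail_part \<tau> (Suc n) = (\<lambda>z. lambert \<tau> (- int (Suc n)) (ee (z + \<tau>)) +
      (- 1) ^ n * (\<Sum>j. conj_part (Suc n) (z + of_nat (Suc j) * \<tau>)))"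
    by (simp add: fun_eq_iff tail_part_def)
  have "has_wirtinger (tail_part \<tau> (Suc n)) (2 * of_real pi * \<i> * tail_part \<tau> n z)
     (0 + (- 1) ^ n * (\<Sum>j. conj_part_cnj_deriv n (z + of_nat (Suc j) * \<tau>))) z"
    unfolding eq
    by (rule has_wirtinger_eq_rhs[OF has_wirtinger_add[OF L has_wirtinger_cmult[OF W]] _ refl])
       (unfold sum_eq, simp add: tail_part_def ring_distribs mult_ac del: of_nat_Suc)
  thus thesis by (rule that)
qed

text \<open>The first translate of \<open>z\<close> becomes the head at \<open>z + \<tau>\<close>:
  \<open>lambert_rec\<close> extracts it from the holomorphic part, the first summand from the
  other.\<close>

lemma tail_part_rec:
  assumes \<tau>: "Im \<tau> > 0" and z: "Im z > - Im \<tau>"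
  shows "tail_part \<tau> n z = head_part n (z + \<tau>) + tail_part \<tau> n (z + \<tau>)"
proof -
  have "(\<Sum>j. conj_part n (z + of_nat (Suc j) * \<tau>)) =
      conj_part n (z + \<tau>) + (\<Sum>j. conj_part n (z + \<tau> + of_nat (Suc j) * \<tau>))"
    using suminf_split_head[OF summable_conj_part[OF \<tau> z, of n]] by (simp add: algebra_simps)
  moreover have "lambert \<tau> (- int n) (ee (z + \<tau>)) =
      polylog n (ee (z + \<tau>)) + lambert \<tau> (- int n) (ee (z + \<tau> + \<tau>))"
    using z by (intro lambert_rec \<tau>) auto
  ultimately show ?thesis
    by (simp add: tail_part_def head_part_def ring_distribs)
qed

section \<open>Bernoulli polynomials\<close>

text \<open>Makes the division in the generating function exact, so that factors may be regrouped
  and cancelled.\<close>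

lemma fps_exp_1_minus_1_dvd: "fps_exp 1 - 1 dvd (fps_X :: real fps)"
proof -
  have "fps_exp 1 - 1 \<noteq> (0 :: real fps)" by (simp add: fps_eq_iff exI[of _ 1])
  moreover have "subdegree (fps_exp 1 - 1 :: real fps) \<le> 1" by (rule subdegree_leI) simp
  ultimately show ?thesis by (simp add: fps_dvd_iff)
qed

lemma bernoulli_poly_eq:
  "bernoulli_poly n x = fact n * fps_nth (fps_exp x * (fps_X / (fps_exp 1 - 1))) n"
proof -
  let ?D = "fps_exp 1 - 1 :: real fps"
  have "fps_X * fps_exp x / ?D = fps_exp x * (fps_X / ?D)"
    using fps_exp_1_minus_1_dvd by (simp add: mult.commute[of fps_X] div_mult_swap)
  thus ?thesis by (simp add: bernoulli_poly_def)
qed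

text \<open>In the generating function the difference of the exponentials is
  \<open>fps_exp x * (fps_exp 1 - 1)\<close>, whose last factor cancels the denominator.\<close>

lemma bernoulli_poly_add_1:
  "bernoulli_poly (Suc n) (x + 1) = bernoulli_poly (Suc n) x + real (Suc n) * x ^ n"
proof -
  let ?D = "fps_exp 1 - 1 :: real fps"
  have "fps_exp (x + 1) * (fps_X / ?D) = fps_exp x * (fps_X / ?D) + fps_exp x * (?D * (fps_X / ?D))"
    by (simp add: fps_exp_add_mult algebra_simps)
  also have "?D * (fps_X / ?D) = fps_X" using fps_exp_1_minus_1_dvd by simp
  finally show ?thesis
    by (simp add: bernoulli_poly_eq algebra_simps)
qed

lemma bernoulli_poly_1: "bernoulli_poly (Suc 0) x = x - 1 / 2"
proof -
  let ?D = "fps_exp 1 - 1 :: real fps"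
  define b where "b = fps_X / ?D"
  have *: "?D * b = fps_X" unfolding b_def using fps_exp_1_minus_1_dvd by simp
  \<comment> \<open>The first two Bernoulli numbers follow by comparing coefficients of
    \<open>X\<close> and \<open>X ^ 2\<close>.\<close>
  have "fps_nth (?D * b) 1 = 1" "fps_nth (?D * b) 2 = 0" unfolding * by simp_all
  hence "fps_nth b 0 = 1" "fps_nth b 1 = - 1 / 2"
    by (simp_all add: fps_mult_nth numeral_2_eq_2)
  thus ?thesis
    by (simp add: bernoulli_poly_eq b_def[symmetric] fps_mult_nth)
qed

lemma has_field_derivative_bernoulli_poly:
  "(bernoulli_poly (Suc n) has_real_derivative real (Suc n) * bernoulli_poly n x) (at x)"
proof -
  define b where "b = fps_nth (fps_X / (fps_exp 1 - 1) :: real fps)"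
  have B: "bernoulli_poly m = (\<lambda>x. fact m * (\<Sum>i\<le>m. x ^ i / fact i * b (m - i)))" for m
    by (simp add: fun_eq_iff bernoulli_poly_eq fps_mult_nth b_def atMost_atLeast0)
  have "((\<lambda>x. x ^ i / fact i * b (Suc n - i)) has_real_derivative
      (case i of 0 \<Rightarrow> 0 | Suc i \<Rightarrow> x ^ i / fact i * b (n - i))) (at x)" for i
  proof (cases i)
    case (Suc k)
    have "((\<lambda>x. x ^ Suc k / fact (Suc k) * b (Suc n - Suc k)) has_real_derivative
        real (Suc k) * x ^ k / fact (Suc k) * b (Suc n - Suc k)) (at x)"
      by (auto intro!: derivative_eq_intros simp del: power_Suc of_nat_Suc fact_Suc)
    thus ?thesis by (simp add: Suc divide_simps del: of_nat_Suc power_Suc)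
  qed auto
  hence "((\<lambda>x. fact (Suc n) * (\<Sum>i\<le>Suc n. x ^ i / fact i * b (Suc n - i))) has_real_derivative
      fact (Suc n) * (\<Sum>i\<le>Suc n. (case i of 0 \<Rightarrow> 0 | Suc i \<Rightarrow> x ^ i / fact i * b (n - i)))) (at x)"
    by (intro DERIV_cmult DERIV_sum)
  also have "(\<Sum>i\<le>Suc n. (case i of 0 \<Rightarrow> 0 | Suc i \<Rightarrow> x ^ i / fact i * b (n - i))) =
      (\<Sum>i\<le>n. x ^ i / fact i * b (n - i))"
    by (subst sum.atMost_Suc_shift) simp
  finally show ?thesis unfolding B by (simp add: mult_ac)
qed

section \<open>The completed functions in the fundamental strip\<close>

text \<open>At negative indices \<open>1 / (1 - 1 / q) = - q / (1 - q)\<close> restores positive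
  powers and replaces \<open>z\<close> by \<open>\<tau> - z\<close>; the remaining signs combine to
  \<open>(- 1) powi k\<close>. Summability is used to pull this constant out.\<close>

lemma E_series_eq_suminf:
  assumes \<tau>: "Im \<tau> > 0"
    and s: "summable (\<lambda>j. 1 / (1 - ee \<tau> ^ Suc j) * of_nat (Suc j) powi (k - 1) * ee (\<tau> - z) ^ Suc j)"
  shows "E_series k z \<tau> =
    (\<Sum>j. 1 / (1 - ee \<tau> ^ Suc j) * of_nat (Suc j) powi (k - 1) * ee z ^ Suc j) +
    (- 1) powi k * (\<Sum>j. 1 / (1 - ee \<tau> ^ Suc j) * of_nat (Suc j) powi (k - 1) * ee (\<tau> - z) ^ Suc j)"
proof -
  have pow: "of_nat m powi (2 - k - 1) = inverse (of_nat m powi (k - 1) :: complex)" for m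
    using power_int_minus[of "of_nat m :: complex" "k - 1"] by simp
  have 1: "E_term k z \<tau> (int (Suc j)) =
      1 / (1 - ee \<tau> ^ Suc j) * of_nat (Suc j) powi (k - 1) * ee z ^ Suc j" for j
    unfolding E_term_def Let_def ee_def[symmetric] of_int_of_nat_eq pow power_int_of_nat
    by (simp add: field_simps del: of_nat_Suc power_Suc)
  have 2: "E_term k z \<tau> (- int (Suc j)) = (- 1) powi k *
      (1 / (1 - ee \<tau> ^ Suc j) * of_nat (Suc j) powi (k - 1) * ee (\<tau> - z) ^ Suc j)" for j
  proof -
    define N where "N = (of_nat (Suc j) :: complex)"
    define q where "q = ee \<tau> ^ Suc j"
    define x where "x = ee z ^ Suc j"
    have q: "q \<noteq> 1" "q \<noteq> 0" "x \<noteq> 0" using ee_power_neq_1[OF \<tau>, of j] by (auto simp: q_def x_def)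
    have sgn: "(- N) powi (2 - k - 1) = (- 1) powi (2 - k - 1) * inverse (N powi (k - 1))"
      unfolding N_def pow[symmetric]
      by (metis mult_minus_left mult_1 power_int_mult_distrib)
    have par: "(- 1) powi (2 - k - 1) = - ((- 1) powi k :: complex)"
      by (cases "even k") auto
    have par2: "(- 1) powi k * (- 1) powi k = (1 :: complex)"
      by (cases "even k") auto
    have "E_term k z \<tau> (- int (Suc j)) =
        inverse x / ((- N) powi (2 - k - 1) * (1 - inverse q))"
      unfolding E_term_def Let_def ee_def[symmetric] of_int_minus of_int_of_nat_eq power_int_minus
        power_int_of_nat N_def q_def x_def ..
    also have "\<dots> = (- 1) powi k * (1 / (1 - q) * N powi (k - 1) * (q / x))"
      unfolding sgn par using q par2
      by (simp add: field_simps)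
    also have "q / x = ee (\<tau> - z) ^ Suc j"
      by (simp only: ee_diff q_def x_def power_divide)
    finally show ?thesis unfolding N_def q_def .
  qed
  show ?thesis unfolding E_series_def 1 2 using suminf_mult[OF s] by simp
qed

lemma E_series_eq_lambert:
  assumes z: "0 < Im z" "Im z < Im \<tau>"
  shows "E_series k z \<tau> = lambert \<tau> (k - 1) (ee z) + (- 1) powi k * lambert \<tau> (k - 1) (ee (\<tau> - z))"
proof -
  have \<tau>: "Im \<tau> > 0" using z by simp
  have "norm (ee z) < 1" "norm (ee (\<tau> - z)) < 1" using z by (simp_all add: norm_ee_less_1_iff)
  note s = lambert_sums[OF \<tau> this(1), of "k - 1"] lambert_sums[OF \<tau> this(2), of "k - 1"]
  show ?thesis
    using E_series_eq_suminf[OF \<tau> sums_summable[OF s(2)]] s by (simp add: sums_iff)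
qed

lemma E_series_nonpos_eq:
  assumes z: "0 \<le> Im z" "Im z < Im \<tau>" "ee z \<noteq> 1" and n: "n \<ge> 1"
  shows "E_series (1 - int n) z \<tau> = polylog n (ee z) + lambert \<tau> (- int n) (ee (z + \<tau>)) +
    (- 1) ^ Suc n * lambert \<tau> (- int n) (ee (- z + \<tau>))"
proof -
  have \<tau>: "Im \<tau> > 0" using z by simp
  have z': "norm (ee z) < 1 \<or> n \<ge> 1 \<and> norm (ee z) \<le> 1 \<and> ee z \<noteq> 1"
    using z n by (simp add: norm_ee_le_1_iff)
  have "norm (ee (\<tau> - z)) < 1" using z by (simp add: norm_ee_less_1_iff)
  note s = lambert_sums_closed_disc[OF \<tau> z'] lambert_sums[OF \<tau> this, of "- int n"]
  have k: "(1 - int n) - 1 = - int n" by simp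
  have "(- 1) powi (1 - int n) = (- 1 :: complex) ^ Suc n"
    by (cases "even n") auto
  with E_series_eq_suminf[OF \<tau>, of "1 - int n" z, unfolded k, OF sums_summable[OF s(2)]] s show ?thesis
    by (simp add: sums_iff ee_add del: power_Suc)
qed

text \<open>The floor is 0 here. The first double sum starts at \<open>l = 1\<close> and runs over
  translates of \<open>- z\<close>; the second starts at \<open>l = 0\<close>, and that term is
  singled out to join the head.\<close>

lemma E_minus_eq:
  assumes z: "0 \<le> Im z" "Im z < Im \<tau>" "ee z \<noteq> 1" and n: "n \<ge> 1"
  shows "E_minus (1 - int n) z \<tau> = (\<Sum>j. conj_part n (- z + of_nat (Suc j) * \<tau>)) +
    (- 1) ^ Suc n * (conj_part n z + (\<Sum>j. conj_part n (z + of_nat (Suc j) * \<tau>)))"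
proof -
  have \<tau>: "Im \<tau> > 0" using z by simp
  have N: "\<lfloor>Im z / Im \<tau>\<rfloor> = 0" using z by (simp add: floor_eq_iff)
  have a: "2 - (1 - int n) = int (Suc n)" "int (Suc n) - 1 = int n" by simp_all
  have Im1: "Im (- z + of_nat (Suc j) * \<tau>) > 0" for j
  proof -
    have "real (Suc j) * Im \<tau> \<ge> Im \<tau>" using \<tau> by (simp add: algebra_simps)
    moreover have "Im (- z + of_nat (Suc j) * \<tau>) = real (Suc j) * Im \<tau> - Im z" by simp
    ultimately show ?thesis using z by linarith
  qed
  have Im2: "Im (z + of_nat j * \<tau>) \<ge> 0" for j using z \<tau> by simp
  have ne: "ee (z + of_nat j * \<tau>) \<noteq> 1" for j
  proof (cases j)
    case (Suc i)
    have "real j * Im \<tau> > 0" using \<tau> Suc by simp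
    hence "Im (z + of_nat j * \<tau>) > 0" using z by simp
    thus ?thesis using norm_ee_less_1_iff[of "z + of_nat j * \<tau>"] by auto
  qed (use z in auto)
  have A: "(\<Sum>i. let l = 1 + 0 + int j; m = Suc i in
          of_real (Gamma_star (nat (int n)) (4 * pi * real m * (of_int l - Im z / Im \<tau>) * Im \<tau>))
            / of_nat m powi int n
            * exp (2 * of_real pi * \<i> * of_nat m * (z - of_int l * \<tau>))) =
        conj_part n (- z + of_nat (Suc j) * \<tau>)" for j
  proof -
    let ?w = "- z + of_nat (Suc j) * \<tau>"
    have ne': "ee ?w \<noteq> 1" using Im1[of j] norm_ee_less_1_iff[of ?w] by auto
    have "4 * pi * real (Suc i) * (of_int (1 + 0 + int j) - Im z / Im \<tau>) * Im \<tau> =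
        4 * pi * real (Suc i) * Im ?w" for i
      using \<tau> by (simp add: field_simps)
    moreover have "2 * of_real pi * \<i> * of_nat (Suc i) * (z - of_int (1 + 0 + int j) * \<tau>) =
        - 2 * of_real pi * \<i> * of_nat (Suc i) * ?w" for i
      by (simp add: algebra_simps)
    ultimately show ?thesis
      unfolding Let_def nat_int using conj_part_sums[OF less_imp_le[OF Im1[of j]] ne', of n]
      by (simp only: sums_iff)
  qed
  have B: "(\<Sum>i. let l = - 0 + int j; m = Suc i in
          of_real (Gamma_star (nat (int n)) (4 * pi * real m * (of_int l + Im z / Im \<tau>) * Im \<tau>))
            / of_nat m powi int n
            * exp (- 2 * of_real pi * \<i> * of_nat m * (z + of_int l * \<tau>))) =
        conj_part n (z + of_nat j * \<tau>)" for j
  proof -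
    let ?w = "z + of_nat j * \<tau>"
    have "4 * pi * real (Suc i) * (of_int (- 0 + int j) + Im z / Im \<tau>) * Im \<tau> =
        4 * pi * real (Suc i) * Im ?w" for i
      using \<tau> by (simp add: field_simps)
    moreover have "z + of_int (- 0 + int j) * \<tau> = ?w" by simp
    ultimately show ?thesis
      unfolding Let_def nat_int using conj_part_sums[OF Im2[of j] ne, of n]
      by (simp only: sums_iff)
  qed
  have "summable (\<lambda>j. conj_part n (z + of_nat (Suc j) * \<tau>))"
    by (rule summable_conj_part[OF \<tau>]) (use z in auto)
  hence s: "summable (\<lambda>j. conj_part n (z + of_nat j * \<tau>))"
    by (subst (asm) summable_Suc_iff)
  have "(\<Sum>j. conj_part n (z + of_nat j * \<tau>)) = conj_part n z + (\<Sum>j. conj_part n (z + of_nat (Suc j) * \<tau>))"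
    using suminf_split_head[OF s] by (simp del: of_nat_Suc)
  thus ?thesis
    unfolding E_minus_def Let_def[of "int (Suc n)"] Let_def[of "Im z"] Let_def[of "Im \<tau>"] N Let_def[of "0::int"] a A B
    by (simp only: power_int_of_nat)
qed

text \<open>\<open>E_hat\<close> on the fundamental strip freed of floor and fractional part. The
  index is \<open>n = a - 1\<close>, with \<open>n = 0\<close> covering
  \<open>a = 1\<close>.\<close>

definition E_hat_strip :: "complex \<Rightarrow> nat \<Rightarrow> complex \<Rightarrow> complex" where
  "E_hat_strip \<tau> n z = head_part n z + tail_part \<tau> n z + (- 1) ^ Suc n * tail_part \<tau> n (- z) -
     of_real ((- 4 * pi * Im \<tau>) ^ n * bernoulli_poly (Suc n) (Im z / Im \<tau>) / fact (Suc n))"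

lemma E_hat_eq_strip:
  assumes z: "0 \<le> Im z" "Im z < Im \<tau>" "ee z \<noteq> 1" and n: "n \<ge> 1"
  shows "E_hat (1 - int n) z \<tau> = E_hat_strip \<tau> n z"
proof -
  have \<tau>: "Im \<tau> > 0" using z by simp
  have N: "\<lfloor>Im z / Im \<tau>\<rfloor> = 0" using z by (simp add: floor_eq_iff)
  hence frac: "frac (Im z / Im \<tau>) = Im z / Im \<tau>" by (simp add: frac_def)
  have a: "2 - (1 - int n) = int (Suc n)" "int (Suc n) - 1 = int n" by simp_all
  have c: "(int (Suc n) = 1) = False" "(int (Suc n) = 0) = False" "(int (Suc n) \<le> - 1) = False"
    using n by auto
  have c': "(1 - int n \<ge> 1) = False" using n by auto
  have sq: "(- 1) ^ n * ((- 1) ^ n * x) = (x::complex)" for x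
    by (simp add: mult.assoc[symmetric] power_mult_distrib[symmetric])
  have "E_hat (1 - int n) z \<tau> = E_series (1 - int n) z \<tau> -
      of_real ((- 4 * pi * Im \<tau>) powi int n * bernoulli_poly (Suc n) (Im z / Im \<tau>) / fact (Suc n)) +
      E_minus (1 - int n) z \<tau>"
    unfolding E_hat_def Let_def a c if_False E_fun_def c' N frac nat_int by simp
  thus ?thesis
    unfolding E_series_nonpos_eq[OF assms] E_minus_eq[OF assms] E_hat_strip_def head_part_def tail_part_def
    by (simp add: ring_distribs sq)
qed

section \<open>Meromorphic continuation\<close>

lemma ee_translate_neq_1:
  assumes "z \<notin> period_lattice \<tau>"
  shows "ee (z + of_int m * \<tau>) \<noteq> 1"
proof
  assume "ee (z + of_int m * \<tau>) = 1"
  then obtain n where "z + of_int m * \<tau> = of_int n" unfolding ee_eq_1_iff by (auto elim: Ints_cases)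
  hence "z = of_int (- m) * \<tau> + of_int n" by (simp add: algebra_simps)
  with assms show False unfolding period_lattice_def by blast
qed

lemma period_lattice_shift_iff:
  "z + of_int m * \<tau> \<in> period_lattice \<tau> \<longleftrightarrow> z \<in> period_lattice \<tau>"
proof -
  have "w + of_int m * \<tau> \<in> period_lattice \<tau>" if w: "w \<in> period_lattice \<tau>" for w m
  proof -
    from w obtain i j where "w = of_int i * \<tau> + of_int j" by (auto simp: period_lattice_def)
    hence "w + of_int m * \<tau> = of_int (i + m) * \<tau> + of_int j" by (simp add: algebra_simps)
    thus ?thesis unfolding period_lattice_def by blast
  qed
  from this[of z m] this[of "z + of_int m * \<tau>" "- m"] show ?thesis by auto
qed

text \<open>
  The continuation to the whole plane of \<open>\<Sum>\<^sub>n\<^sub>\<ge>\<^sub>1 \<zeta>\<^sup>n / (1 - q\<^sup>n)\<close>, which converges for \<open>Im z > 0\<close>. The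
  number \<open>M\<close> of split-off terms only has to be large enough.
\<close>

definition half_sum_upto :: "complex \<Rightarrow> nat \<Rightarrow> complex \<Rightarrow> complex" where
  "half_sum_upto \<tau> M z = (\<Sum>l<M. polylog 0 (ee (z + of_nat l * \<tau>))) + lambert \<tau> 0 (ee (z + of_nat M * \<tau>))"

definition half_sum :: "complex \<Rightarrow> complex \<Rightarrow> complex" where
  "half_sum \<tau> z = half_sum_upto \<tau> (nat \<lceil>1 - Im z / Im \<tau>\<rceil>) z"

text \<open>By \<open>lambert_rec\<close>, splitting off one more term changes nothing once the
  Lambert series converges.\<close>

lemma half_sum_eq:
  assumes \<tau>: "Im \<tau> > 0" and M: "Im z + real M * Im \<tau> > 0"
  shows "half_sum \<tau> z = half_sum_upto \<tau> M z"
proof -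
  have step: "half_sum_upto \<tau> (Suc N) z = half_sum_upto \<tau> N z" if "Im z + real N * Im \<tau> > 0" for N
    using lambert_rec[OF \<tau>, of "z + of_nat N * \<tau>" 0] that
    by (simp add: half_sum_upto_def algebra_simps)
  have mono: "half_sum_upto \<tau> N' z = half_sum_upto \<tau> N z" if "Im z + real N * Im \<tau> > 0" "N \<le> N'" for N N'
    using that(2)
  proof (induction rule: dec_induct)
    case (step m)
    have "real N * Im \<tau> \<le> real m * Im \<tau>" using step \<tau> by simp
    with that(1) have "Im z + real m * Im \<tau> > 0" by linarith
    from \<open>half_sum_upto \<tau> m z = half_sum_upto \<tau> N z\<close> assms(1) this show ?case
      using \<open>\<And>N. 0 < Im z + real N * Im \<tau> \<Longrightarrow> half_sum_upto \<tau> (Suc N) z = half_sum_upto \<tau> N z\<close> by simp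
  qed simp
  \<comment> \<open>This choice ensures \<open>Im z + K * Im \<tau> \<ge> Im \<tau>\<close>.\<close>
  define K where "K = nat \<lceil>1 - Im z / Im \<tau>\<rceil>"
  have "real K \<ge> 1 - Im z / Im \<tau>" unfolding K_def by linarith
  hence "real K * Im \<tau> \<ge> (1 - Im z / Im \<tau>) * Im \<tau>" using \<tau> by (intro mult_right_mono) auto
  hence K: "Im z + real K * Im \<tau> > 0" using \<tau> by (simp add: left_diff_distrib)
  show ?thesis unfolding half_sum_def K_def[symmetric]
    using mono[OF K, of M] mono[OF M, of K] by (cases "K \<le> M") auto
qed

lemma half_sum_eq_lambert:
  "Im \<tau> > 0 \<Longrightarrow> Im z > 0 \<Longrightarrow> half_sum \<tau> z = lambert \<tau> 0 (ee z)"
  using half_sum_eq[of \<tau> z 0] by (simp add: half_sum_upto_def)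

lemma half_sum_rec:
  assumes \<tau>: "Im \<tau> > 0"
  shows "half_sum \<tau> z = polylog 0 (ee z) + half_sum \<tau> (z + \<tau>)"
proof -
  obtain M where "real M > - Im z / Im \<tau>" using reals_Archimedean2 by blast
  hence M: "Im z + real M * Im \<tau> > 0" using \<tau> by (simp add: field_simps)
  have "half_sum \<tau> z = half_sum_upto \<tau> (Suc M) z"
    by (rule half_sum_eq[OF \<tau>]) (use M \<tau> in \<open>simp add: ring_distribs\<close>)
  moreover have "half_sum \<tau> (z + \<tau>) = half_sum_upto \<tau> M (z + \<tau>)"
    by (rule half_sum_eq[OF \<tau>]) (use M \<tau> in simp)
  ultimately show ?thesis
    unfolding half_sum_upto_def sum.lessThan_Suc_shift by (simp add: algebra_simps)
qed

text \<open>The number of split-off terms in \<open>half_sum\<close> varies with the point; near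
  \<open>z\<close> a fixed one works, which makes local regularity accessible.\<close>

lemma half_sum_locally:
  assumes \<tau>: "Im \<tau> > 0"
  obtains M where "Im z + real M * Im \<tau> > 0"
    "eventually (\<lambda>w. half_sum \<tau> w = half_sum_upto \<tau> M w) (nhds z)"
proof -
  obtain M where "real M > - Im z / Im \<tau>" using reals_Archimedean2 by blast
  hence M: "Im z + real M * Im \<tau> > 0" using \<tau> by (simp add: field_simps)
  have "eventually (\<lambda>w. w \<in> {w. Im w > - real M * Im \<tau>}) (nhds z)"
    by (rule eventually_nhds_in_open[OF open_halfspace_Im_gt]) (use M in simp)
  hence "eventually (\<lambda>w. half_sum \<tau> w = half_sum_upto \<tau> M w) (nhds z)"
    by eventually_elim (auto intro!: half_sum_eq[OF \<tau>])
  with M show thesis by (rule that)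
qed

lemma lambert_analytic:
  assumes \<tau>: "Im \<tau> > 0" and z: "Im (z + c) > 0"
  shows "(\<lambda>z. lambert \<tau> k (ee (z + c))) analytic_on {z}"
proof -
  have S: "open {w. Im w > - Im c}" by (rule open_halfspace_Im_gt)
  have "(\<lambda>z. lambert \<tau> k (ee (z + c))) holomorphic_on {w. Im w > - Im c}"
  proof (subst holomorphic_on_open[OF S], intro ballI exI)
    fix w assume "w \<in> {w. Im w > - Im c}"
    thus "((\<lambda>z. lambert \<tau> k (ee (z + c))) has_field_derivative
        2 * of_real pi * \<i> * lambert \<tau> (k + 1) (ee (w + c)) * 1) (at w)"
      by (intro DERIV_chain2[OF has_field_derivative_lambert_ee[OF \<tau>]])
         (auto intro!: derivative_eq_intros)
  qed
  with S z show ?thesis by (subst analytic_at) auto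
qed

lemma ee_analytic: "(\<lambda>z. ee (z + c)) analytic_on A"
  unfolding ee_def by (intro analytic_intros)

lemma half_sum_meromorphic:
  assumes \<tau>: "Im \<tau> > 0"
  shows "half_sum \<tau> meromorphic_on UNIV"
proof (subst meromorphic_on_meromorphic_at, intro ballI)
  fix z :: complex
  obtain M where M: "Im z + real M * Im \<tau> > 0"
    "eventually (\<lambda>w. half_sum \<tau> w = half_sum_upto \<tau> M w) (nhds z)"
    using half_sum_locally[OF \<tau>] by blast
  have "half_sum_upto \<tau> M meromorphic_on {z}"
    unfolding half_sum_upto_def polylog.simps(1)
    by (intro meromorphic_intros analytic_on_imp_meromorphic_on ee_analytic lambert_analytic \<tau>)
       (use M in auto)
  thus "half_sum \<tau> meromorphic_on {z}"
    by (subst meromorphic_on_cong) (use M(2) in \<open>auto simp: eventually_nhds_conv_at\<close>)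
qed

lemma half_sum_analytic:
  assumes \<tau>: "Im \<tau> > 0" and z: "z \<notin> period_lattice \<tau>"
  shows "half_sum \<tau> analytic_on {z}"
proof -
  obtain M where M: "Im z + real M * Im \<tau> > 0"
    "eventually (\<lambda>w. half_sum \<tau> w = half_sum_upto \<tau> M w) (nhds z)"
    using half_sum_locally[OF \<tau>] by blast
  have "1 - ee (z + of_nat l * \<tau>) \<noteq> 0" for l
    using ee_translate_neq_1[OF z, of "int l"] by auto
  hence "half_sum_upto \<tau> M analytic_on {z}"
    unfolding half_sum_upto_def polylog.simps(1)
    by (intro analytic_intros ee_analytic lambert_analytic \<tau>) (use M in auto)
  thus ?thesis
    by (simp only: analytic_at_cong[OF M(2) refl])
qed

section \<open>The continuation for subscript 1 and its quasi-periodicity\<close>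

definition E1_sum :: "complex \<Rightarrow> complex \<Rightarrow> complex" where
  "E1_sum \<tau> z = half_sum \<tau> z - half_sum \<tau> (\<tau> - z)"

text \<open>One period subtracts \<open>polylog 0 (ee z)\<close> from the first half sum and adds
  \<open>polylog 0 (ee (- z))\<close> to the second; these two add up to \<open>- 1\<close>. In
  \<open>E_hat\<close> the resulting shift cancels against that of \<open>y / v\<close>.\<close>

lemma E1_sum_add_period:
  assumes \<tau>: "Im \<tau> > 0" and z: "z \<notin> period_lattice \<tau>"
  shows "E1_sum \<tau> (z + of_int m * \<tau>) = E1_sum \<tau> z + of_int m"
proof -
  have step: "E1_sum \<tau> (z + \<tau>) = E1_sum \<tau> z + 1" if "z \<notin> period_lattice \<tau>" for z
  proof -
    have "ee z \<noteq> 1" using ee_translate_neq_1[OF that, of 0] by simp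
    from polylog_0_ee_minus[OF this]
    show ?thesis
      using half_sum_rec[OF \<tau>, of z] half_sum_rec[OF \<tau>, of "- z"]
      by (simp add: E1_sum_def algebra_simps)
  qed
  have nat: "E1_sum \<tau> (z + of_nat n * \<tau>) = E1_sum \<tau> z + of_nat n" if "z \<notin> period_lattice \<tau>" for n z
  proof (induction n)
    case (Suc n)
    have "z + of_nat n * \<tau> \<notin> period_lattice \<tau>"
      using period_lattice_shift_iff[of z "int n" \<tau>] that by simp
    from step[OF this] Suc show ?case by (simp add: algebra_simps)
  qed simp
  show ?thesis
  proof (cases m)
    case (nonneg n)
    thus ?thesis using nat[OF z, of n] by simp
  next
    case (neg n)
    \<comment> \<open>A backward shift is a forward shift starting at the translated point.\<close>
    have "z + of_int m * \<tau> \<notin> period_lattice \<tau>" using period_lattice_shift_iff z by simp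
    from nat[OF this, of "Suc n"] show ?thesis unfolding neg by (simp add: algebra_simps)
  qed
qed

lemma E1_sum_meromorphic:
  assumes \<tau>: "Im \<tau> > 0"
  shows "E1_sum \<tau> meromorphic_on UNIV"
proof -
  have "(\<lambda>z. half_sum \<tau> (\<tau> - z)) meromorphic_on UNIV"
    by (rule meromorphic_on_compose[OF half_sum_meromorphic[OF \<tau>]]) (auto intro!: analytic_intros)
  thus ?thesis unfolding E1_sum_def
    by (intro meromorphic_intros half_sum_meromorphic \<tau>)
qed

lemma E1_sum_analytic:
  assumes \<tau>: "Im \<tau> > 0" and z: "z \<notin> period_lattice \<tau>"
  shows "E1_sum \<tau> analytic_on {z}"
proof -
  have "\<tau> - z \<notin> period_lattice \<tau>"
  proof
    assume "\<tau> - z \<in> period_lattice \<tau>"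
    then obtain m n where "\<tau> - z = of_int m * \<tau> + of_int n" by (auto simp: period_lattice_def)
    hence "z = of_int (1 - m) * \<tau> + of_int (- n)" by (simp add: algebra_simps)
    with z show False unfolding period_lattice_def by blast
  qed
  hence "half_sum \<tau> analytic_on (\<lambda>z. \<tau> - z) ` {z}"
    using half_sum_analytic[OF \<tau>] by simp
  from analytic_on_compose[OF _ this] have "(\<lambda>z. half_sum \<tau> (\<tau> - z)) analytic_on {z}"
    by (simp add: o_def analytic_intros)
  thus ?thesis unfolding E1_sum_def
    by (intro analytic_intros half_sum_analytic \<tau> z)
qed

lemma strip_not_in_period_lattice:
  assumes "0 < Im z" "Im z < Im \<tau>"
  shows "z \<notin> period_lattice \<tau>"
proof
  assume "z \<in> period_lattice \<tau>"
  then obtain m n where z: "z = of_int m * \<tau> + of_int n" by (auto simp: period_lattice_def)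
  hence "0 < of_int m * Im \<tau>" "of_int m * Im \<tau> < 1 * Im \<tau>" using assms by simp_all
  hence "0 < (of_int m :: real)" "(of_int m :: real) < 1"
    using assms by (auto simp: zero_less_mult_iff mult_less_cancel_right)
  thus False by simp
qed

lemma is_E_continuation_1:
  assumes \<tau>: "Im \<tau> > 0"
  shows "is_E_continuation 1 \<tau> (remove_sings (E1_sum \<tau>))"
  unfolding is_E_continuation_def
proof (intro conjI allI impI)
  show "remove_sings (E1_sum \<tau>) nicely_meromorphic_on UNIV"
    by (rule remove_sings_nicely_meromorphic[OF E1_sum_meromorphic[OF \<tau>]])
  fix z assume z: "0 < Im z \<and> Im z < Im \<tau>"
  have "remove_sings (E1_sum \<tau>) z = E1_sum \<tau> z"
    by (intro remove_sings_at_analytic E1_sum_analytic \<tau> strip_not_in_period_lattice) (use z in auto)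
  also have "\<dots> = E_series 1 z \<tau>"
    using z \<tau> by (simp add: E1_sum_def half_sum_eq_lambert E_series_eq_lambert)
  finally show "remove_sings (E1_sum \<tau>) z = E_series 1 z \<tau>" .
qed

section \<open>Higher subscripts by differentiation\<close>

lemma has_field_derivative_E_series:
  assumes z: "0 < Im z" "Im z < Im \<tau>"
  shows "((\<lambda>z. E_series k z \<tau>) has_field_derivative 2 * of_real pi * \<i> * E_series (k + 1) z \<tau>) (at z)"
proof -
  have \<tau>: "Im \<tau> > 0" using z by simp
  let ?f = "\<lambda>z. lambert \<tau> (k - 1) (ee z) + (- 1) powi k * lambert \<tau> (k - 1) (ee (\<tau> - z))"
  have "((\<lambda>z. lambert \<tau> (k - 1) (ee (\<tau> - z))) has_field_derivative
      2 * of_real pi * \<i> * lambert \<tau> (k - 1 + 1) (ee (\<tau> - z)) * - 1) (at z)"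
    by (rule DERIV_chain2[OF has_field_derivative_lambert_ee[OF \<tau>]])
       (use z in \<open>auto intro!: derivative_eq_intros\<close>)
  from DERIV_add[OF has_field_derivative_lambert_ee[OF \<tau> z(1), of "k - 1"]
      DERIV_cmult[OF this, of "(- 1) powi k"]]
  have "(?f has_field_derivative 2 * of_real pi * \<i> * E_series (k + 1) z \<tau>) (at z)"
    by (simp add: E_series_eq_lambert[OF z] power_int_add algebra_simps)
  moreover have "eventually (\<lambda>w. w \<in> {w. 0 < Im w} \<inter> {w. Im w < Im \<tau>}) (nhds z)"
    by (intro eventually_nhds_in_open open_Int open_halfspace_Im_gt open_halfspace_Im_lt) (use z in auto)
  hence "eventually (\<lambda>w. ?f w = E_series k w \<tau>) (nhds z)"
    by eventually_elim (auto simp: E_series_eq_lambert)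
  ultimately show ?thesis
    by (subst (asm) DERIV_cong_ev[OF refl _ refl])
qed

text \<open>Differentiating the identity on the strip raises the subscript, so only subscript 1
  needs an explicit construction. \<open>remove_sings\<close> restores the normalisation at the
  poles that makes the continuation unique.\<close>

lemma is_E_continuation_deriv:
  assumes f: "is_E_continuation k \<tau> f" and an: "\<And>z. z \<notin> period_lattice \<tau> \<Longrightarrow> f analytic_on {z}"
  defines "g \<equiv> remove_sings (\<lambda>z. deriv f z / (2 * of_real pi * \<i>))"
  shows "is_E_continuation (k + 1) \<tau> g"
    and "\<And>z. z \<notin> period_lattice \<tau> \<Longrightarrow> g analytic_on {z}"
    and "\<And>z. z \<notin> period_lattice \<tau> \<Longrightarrow>
           (f has_field_derivative 2 * of_real pi * \<i> * g z) (at z)"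
proof -
  have d: "(\<lambda>z. deriv f z / (2 * of_real pi * \<i>)) analytic_on {z}" if "z \<notin> period_lattice \<tau>" for z
    by (intro analytic_intros an that) auto
  show "g analytic_on {z}" if "z \<notin> period_lattice \<tau>" for z
    unfolding g_def by (rule remove_sings_analytic_on[OF d[OF that]])
  show *: "(f has_field_derivative 2 * of_real pi * \<i> * g z) (at z)" if "z \<notin> period_lattice \<tau>" for z
  proof -
    have "g z = deriv f z / (2 * of_real pi * \<i>)"
      unfolding g_def by (rule remove_sings_at_analytic[OF d[OF that]])
    hence "2 * of_real pi * \<i> * g z = deriv f z" by simp
    thus ?thesis
      using an[OF that] analytic_on_imp_differentiable_at DERIV_deriv_iff_field_differentiable by fastforce
  qed
  have fm: "f meromorphic_on UNIV"
    using f by (auto simp: is_E_continuation_def nicely_meromorphic_on_def)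
  show "is_E_continuation (k + 1) \<tau> g"
    unfolding is_E_continuation_def
  proof (intro conjI allI impI)
    show "g nicely_meromorphic_on UNIV"
      unfolding g_def by (intro remove_sings_nicely_meromorphic meromorphic_intros fm)
    fix z assume "0 < Im z \<and> Im z < Im \<tau>"
    hence z: "0 < Im z" "Im z < Im \<tau>" by auto
    have "eventually (\<lambda>w. w \<in> {w. 0 < Im w} \<inter> {w. Im w < Im \<tau>}) (nhds z)"
      by (intro eventually_nhds_in_open open_Int open_halfspace_Im_gt open_halfspace_Im_lt) (use z in auto)
    hence "eventually (\<lambda>w. E_series k w \<tau> = f w) (nhds z)"
      by eventually_elim (use f in \<open>auto simp: is_E_continuation_def\<close>)
    with has_field_derivative_E_series[OF z, of k]
    have "(f has_field_derivative 2 * of_real pi * \<i> * E_series (k + 1) z \<tau>) (at z)"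
      by (subst (asm) DERIV_cong_ev[OF refl _ refl])
    from DERIV_unique[OF this *[OF strip_not_in_period_lattice[OF z]]]
    show "g z = E_series (k + 1) z \<tau>" by simp
  qed
qed

lemma ex_E_continuation:
  assumes \<tau>: "Im \<tau> > 0" and "k \<ge> 1"
  shows "\<exists>f. is_E_continuation k \<tau> f \<and> (\<forall>z. z \<notin> period_lattice \<tau> \<longrightarrow> f analytic_on {z})"
  using assms(2)
proof (induction k rule: int_ge_induct)
  case base
  show ?case
    using is_E_continuation_1[OF \<tau>] remove_sings_analytic_on[OF E1_sum_analytic[OF \<tau>]] by blast
next
  case (step k)
  thus ?case using is_E_continuation_deriv by metis
qed

lemma E_fun_eq:
  assumes "Im \<tau> > 0" "k \<ge> 1" "is_E_continuation k \<tau> f"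
  shows "E_fun k z \<tau> = f z"
proof -
  have "(THE f. is_E_continuation k \<tau> f) = f"
    using assms is_E_continuation_unique by (intro the_equality) auto
  with assms(2) show ?thesis by (simp add: E_fun_def)
qed

lemma has_field_derivative_E_fun:
  assumes \<tau>: "Im \<tau> > 0" and k: "k \<ge> 1" and z: "z \<notin> period_lattice \<tau>"
  shows "((\<lambda>z. E_fun k z \<tau>) has_field_derivative 2 * of_real pi * \<i> * E_fun (k + 1) z \<tau>) (at z)"
proof -
  obtain f where f: "is_E_continuation k \<tau> f" "\<And>z. z \<notin> period_lattice \<tau> \<Longrightarrow> f analytic_on {z}"
    using ex_E_continuation[OF \<tau> k] by blast
  note g = is_E_continuation_deriv[OF f(1)]
  have "is_E_continuation (k + 1) \<tau> (remove_sings (\<lambda>z. deriv f z / (2 * of_real pi * \<i>)))"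
    by (rule g(1)) (rule f(2))
  note c = E_fun_eq[OF \<tau> _ this]
  have "(f has_field_derivative
      2 * of_real pi * \<i> * remove_sings (\<lambda>z. deriv f z / (2 * of_real pi * \<i>)) z) (at z)"
    by (rule g(3)) (use f(2) z in auto)
  thus ?thesis using k by (simp add: E_fun_eq[OF \<tau> _ f(1)] c)
qed

lemma E_fun_1_eq:
  assumes \<tau>: "Im \<tau> > 0" and z: "z \<notin> period_lattice \<tau>"
  shows "E_fun 1 z \<tau> = E1_sum \<tau> z"
  using E_fun_eq[OF \<tau> _ is_E_continuation_1[OF \<tau>]]
  by (simp add: remove_sings_at_analytic[OF E1_sum_analytic[OF \<tau> z]])

text \<open>\<open>conj_part 0\<close> vanishes, so the tails are pure Lambert series, and the
  linear correction is the first Bernoulli polynomial. Splitting one term off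
  \<open>half_sum\<close> includes real \<open>z\<close>.\<close>

lemma E_hat_1_eq_strip:
  assumes z: "0 \<le> Im z" "Im z < Im \<tau>" "z \<notin> period_lattice \<tau>"
  shows "E_hat 1 z \<tau> = E_hat_strip \<tau> 0 z"
proof -
  have \<tau>: "Im \<tau> > 0" using z by simp
  have "E_hat 1 z \<tau> = E1_sum \<tau> z - of_real (Im z / Im \<tau>) + 1 / 2"
    by (simp add: E_hat_def E_fun_1_eq[OF \<tau> z(3)])
  also have "E1_sum \<tau> z = polylog 0 (ee z) + lambert \<tau> 0 (ee (z + \<tau>)) - lambert \<tau> 0 (ee (- z + \<tau>))"
    using z \<tau> by (simp add: E1_sum_def half_sum_rec[OF \<tau>, of z] half_sum_eq_lambert)
  finally show ?thesis
    by (simp add: E_hat_strip_def head_part_def tail_part_def bernoulli_poly_1)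
qed

section \<open>Differentiation of the completed functions\<close>

text \<open>What remains of \<open>E_hat_strip\<close> without the head. It is differentiable for
  \<open>\<bar>Im z\<bar> < Im \<tau>\<close> and serves on both sides of the real line.\<close>

definition common_part :: "complex \<Rightarrow> nat \<Rightarrow> complex \<Rightarrow> complex" where
  "common_part \<tau> n z = tail_part \<tau> n z + (- 1) ^ Suc n * tail_part \<tau> n (- z) -
     of_real ((- 4 * pi * Im \<tau>) ^ n * bernoulli_poly (Suc n) (Im z / Im \<tau>) / fact (Suc n))"

lemma E_hat_strip_eq: "E_hat_strip \<tau> n z = head_part n z + common_part \<tau> n z"
  by (simp add: E_hat_strip_def common_part_def)

lemma has_wirtinger_bernoulli_poly:
  assumes "v > 0"
  shows "has_wirtinger
     (\<lambda>w. of_real ((- 4 * pi * v) ^ Suc n * bernoulli_poly (Suc (Suc n)) (Im w / v) / fact (Suc (Suc n))))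
     (2 * of_real pi * \<i> * of_real ((- 4 * pi * v) ^ n * bernoulli_poly (Suc n) (Im z / v) / fact (Suc n)))
     (- 2 * of_real pi * \<i> * of_real ((- 4 * pi * v) ^ n * bernoulli_poly (Suc n) (Im z / v) / fact (Suc n))) z"
proof -
  let ?b = "\<lambda>n y. (- 4 * pi * v) ^ n * bernoulli_poly (Suc n) (y / v) / fact (Suc n)"
  have "((\<lambda>y. y / v) has_real_derivative 1 / v) (at (Im z))"
    using assms by (auto intro!: derivative_eq_intros)
  from DERIV_cdivide[OF DERIV_cmult[OF DERIV_chain2[OF has_field_derivative_bernoulli_poly this,
        of "Suc n"], of "(- 4 * pi * v) ^ Suc n"], of "fact (Suc (Suc n))"]
  have "((\<lambda>y. ?b (Suc n) y) has_real_derivative (- 4 * pi * v) ^ Suc n *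
      (real (Suc (Suc n)) * bernoulli_poly (Suc n) (Im z / v) * (1 / v)) / fact (Suc (Suc n))) (at (Im z))" .
  also have "(- 4 * pi * v) ^ Suc n *
      (real (Suc (Suc n)) * bernoulli_poly (Suc n) (Im z / v) * (1 / v)) / fact (Suc (Suc n)) =
      - 4 * pi * ?b n (Im z)"
    using assms unfolding fact_Suc[of "Suc n"] power_Suc
    by (simp add: divide_simps del: fact_Suc of_nat_Suc)
  finally have "((\<lambda>y. ?b (Suc n) y) has_real_derivative - 4 * pi * ?b n (Im z)) (at (Im z))" .
  from has_wirtinger_Im[OF this] show ?thesis
    by (rule has_wirtinger_eq_rhs) simp_all
qed

lemma has_wirtinger_common_part:
  assumes \<tau>: "Im \<tau> > 0" and z: "\<bar>Im z\<bar> < Im \<tau>"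
  obtains B where
    "has_wirtinger (common_part \<tau> (Suc n)) (2 * of_real pi * \<i> * common_part \<tau> n z) B z"
proof -
  have z': "- Im \<tau> < Im z" "- Im \<tau> < Im (- z)" using z by auto
  obtain B1 where B1: "has_wirtinger (tail_part \<tau> (Suc n)) (2 * of_real pi * \<i> * tail_part \<tau> n z) B1 z"
    using has_wirtinger_tail_part[OF \<tau> z'(1), of n] by blast
  obtain B2 where B2:
      "has_wirtinger (tail_part \<tau> (Suc n)) (2 * of_real pi * \<i> * tail_part \<tau> n (- z)) B2 (- z)"
    using has_wirtinger_tail_part[OF \<tau> z'(2), of n] by blast
  have eq: "common_part \<tau> (Suc n) = (\<lambda>z. tail_part \<tau> (Suc n) z + (- 1) ^ Suc (Suc n) *
      tail_part \<tau> (Suc n) (- z) - of_real ((- 4 * pi * Im \<tau>) ^ Suc n *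
      bernoulli_poly (Suc (Suc n)) (Im z / Im \<tau>) / fact (Suc (Suc n))))"
    by (rule ext) (simp only: common_part_def)
  show thesis
    by (rule that, unfold eq,
        rule has_wirtinger_eq_rhs[OF has_wirtinger_diff[OF has_wirtinger_add[OF B1
          has_wirtinger_cmult[OF has_wirtinger_minus[OF B2]]] has_wirtinger_bernoulli_poly[OF \<tau>]] _ refl])
       (simp add: common_part_def ring_distribs del: fact_Suc)
qed

section \<open>Matching the formulas above and below the real line\<close>

lemma conj_part_real:
  assumes "Im z = 0"
  shows "conj_part (Suc n) z = polylog (Suc n) (ee (- z))"
proof -
  have "cnj z = z" using assms by (simp add: complex_eq_iff)
  thus ?thesis
    unfolding conj_part_def assms cnj_ee
    by (subst sum.lessThan_Suc_shift) simp
qed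

text \<open>Replaces \<open>head_part\<close> in the formula for \<open>E_hat\<close> just below the real line.\<close>

definition head_reflected :: "nat \<Rightarrow> complex \<Rightarrow> complex" where
  "head_reflected n z = (- 1) ^ Suc n * head_part n (- z) - of_real ((- 4 * pi * Im z) ^ n / fact n)"

lemma ee_real_neq_1:
  assumes "Im z = 0" "ee z \<noteq> 1"
  shows "Re (ee z) < 1" "Re (ee (- z)) < 1"
proof -
  show "Re (ee z) < 1"
    by (rule Re_less_1_if_norm_le_1) (use assms in \<open>auto simp: norm_ee_le_1_iff\<close>)
  show "Re (ee (- z)) < 1"
    by (rule Re_less_1_if_norm_le_1, subst norm_ee_le_1_iff) (use assms in \<open>auto simp: ee_minus\<close>)
qed

text \<open>On the real line only the zeroth power of \<open>Im z\<close> survives in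
  \<open>conj_part\<close>, and \<open>z \<mapsto> - z\<close> then exchanges the two summands of
  the head.\<close>

lemma head_part_minus_real:
  assumes "Im z = 0"
  shows "(- 1) ^ n * head_part (Suc n) (- z) = head_part (Suc n) z"
proof -
  have *: "conj_part (Suc n) z = polylog (Suc n) (ee (- z))" "conj_part (Suc n) (- z) = polylog (Suc n) (ee z)"
    using conj_part_real[of z n] conj_part_real[of "- z" n] assms by simp_all
  show ?thesis
    unfolding head_part_def * by (simp add: ring_distribs)
qed

lemma head_reflected_real:
  assumes "Im z = 0"
  shows "head_reflected (Suc n) z = head_part (Suc n) z"
  using head_part_minus_real[OF assms, of n] by (simp add: head_reflected_def assms)

text \<open>Both derivatives agree with those of \<open>head_part\<close>, as gluing demands. For
  \<open>n \<ge> 1\<close> the derivative of the monomial vanishes on the line and reflection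
  symmetry gives the match; for \<open>n = 0\<close> that derivative is a nonzero constant and
  balances the \<open>- 1\<close> of \<open>polylog_0_ee_minus\<close>.\<close>

lemma has_wirtinger_head_reflected:
  assumes "Im z = 0" "ee z \<noteq> 1"
  shows "has_wirtinger (head_reflected (Suc n)) (2 * of_real pi * \<i> * head_part n z)
           ((- 1) ^ n * conj_part_cnj_deriv n z) z"
proof -
  define p where "p = complex_of_real ((4 * pi * Im z) ^ n / fact n)"
  have eq: "head_reflected (Suc n) = (\<lambda>z. (- 1) ^ n * head_part (Suc n) (- z) -
      (- 1) ^ Suc n * of_real ((4 * pi * Im z) ^ Suc n / fact (Suc n)))"
  proof
    fix z
    have "- 4 * pi * Im z = - 1 * (4 * pi * Im z)" by simp
    hence "(- 4 * pi * Im z) ^ Suc n / fact (Suc n) = (- 1) ^ Suc n * ((4 * pi * Im z) ^ Suc n / fact (Suc n))"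
      by (simp only: power_mult_distrib times_divide_eq_right)
    hence *: "complex_of_real ((- 4 * pi * Im z) ^ Suc n / fact (Suc n)) =
        of_real ((- 1) ^ Suc n * ((4 * pi * Im z) ^ Suc n / fact (Suc n)))" by (simp only:)
    show "head_reflected (Suc n) z = (- 1) ^ n * head_part (Suc n) (- z) -
        (- 1) ^ Suc n * of_real ((4 * pi * Im z) ^ Suc n / fact (Suc n))"
      unfolding head_reflected_def * by simp
  qed
  have "has_wirtinger (head_reflected (Suc n))
      ((- 1) ^ n * - (2 * of_real pi * \<i> * head_part n (- z)) - (- 1) ^ Suc n * (- 2 * of_real pi * \<i> * p))
      ((- 1) ^ n * - ((- 1) ^ n * conj_part_cnj_deriv n (- z)) - (- 1) ^ Suc n * (2 * of_real pi * \<i> * p)) z"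
    unfolding eq p_def
    by (intro has_wirtinger_diff has_wirtinger_cmult has_wirtinger_minus has_wirtinger_power_Im
          has_wirtinger_head_part ee_real_neq_1[OF assms])
  thus ?thesis
  proof (rule has_wirtinger_eq_rhs)
    show "(- 1) ^ n * - (2 * of_real pi * \<i> * head_part n (- z)) - (- 1) ^ Suc n * (- 2 * of_real pi * \<i> * p) =
        2 * of_real pi * \<i> * head_part n z"
    proof (cases n)
      case 0
      thus ?thesis
        using polylog_0_ee_minus[OF assms(2)]
        by (simp add: head_part_def p_def ring_distribs del: polylog.simps)
    next
      case (Suc m)
      have "p = 0" using assms(1) by (simp add: p_def Suc)
      thus ?thesis
        using head_part_minus_real[OF assms(1), of m] by (simp add: Suc algebra_simps)
    qed
    show "(- 1) ^ n * - ((- 1) ^ n * conj_part_cnj_deriv n (- z)) - (- 1) ^ Suc n * (2 * of_real pi * \<i> * p) =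
        (- 1) ^ n * conj_part_cnj_deriv n z"
    proof (cases n)
      case 0
      have "cnj z = z" using assms(1) by (simp add: complex_eq_iff)
      thus ?thesis
        using polylog_0_ee_minus[OF assms(2)] 0
        by (simp add: conj_part_cnj_deriv_def p_def cnj_ee ring_distribs del: polylog.simps)
    next
      case (Suc m)
      thus ?thesis using assms(1) by (simp add: p_def conj_part_cnj_deriv_def)
    qed
  qed
qed

text \<open>One \<open>B\<close> serves both formulas, since gluing needs equal real
  derivatives.\<close>

lemma has_wirtinger_E_hat_strip:
  assumes \<tau>: "Im \<tau> > 0" and z: "0 \<le> Im z" "Im z < Im \<tau>" "ee z \<noteq> 1"
  obtains B where "has_wirtinger (E_hat_strip \<tau> (Suc n)) (2 * of_real pi * \<i> * E_hat_strip \<tau> n z) B z"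
    "Im z = 0 \<Longrightarrow> has_wirtinger (\<lambda>z. head_reflected (Suc n) z + common_part \<tau> (Suc n) z)
        (2 * of_real pi * \<i> * E_hat_strip \<tau> n z) B z"
proof -
  have Re: "Re (ee z) < 1"
    using z by (intro Re_less_1_if_norm_le_1) (auto simp: norm_ee_le_1_iff)
  obtain C where C: "has_wirtinger (common_part \<tau> (Suc n)) (2 * of_real pi * \<i> * common_part \<tau> n z) C z"
    using has_wirtinger_common_part[OF \<tau>, of z n] z by auto
  have eq: "E_hat_strip \<tau> (Suc n) = (\<lambda>z. head_part (Suc n) z + common_part \<tau> (Suc n) z)"
    by (simp add: fun_eq_iff E_hat_strip_eq)
  show thesis
  proof (rule that)
    show "has_wirtinger (E_hat_strip \<tau> (Suc n)) (2 * of_real pi * \<i> * E_hat_strip \<tau> n z)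
        ((- 1) ^ n * conj_part_cnj_deriv n z + C) z"
      unfolding eq E_hat_strip_eq distrib_left
      by (intro has_wirtinger_add has_wirtinger_head_part Re C)
    show "has_wirtinger (\<lambda>z. head_reflected (Suc n) z + common_part \<tau> (Suc n) z)
        (2 * of_real pi * \<i> * E_hat_strip \<tau> n z) ((- 1) ^ n * conj_part_cnj_deriv n z + C) z"
      if "Im z = 0"
      unfolding E_hat_strip_eq distrib_left
      by (intro has_wirtinger_add has_wirtinger_head_reflected that z C)
  qed
qed

text \<open>Source of \<open>head_reflected\<close>: the head at \<open>w + \<tau>\<close> is
  absorbed into the tail at \<open>w\<close>, while the tail at \<open>- (w + \<tau>)\<close>
  releases the head at \<open>- w\<close>. The monomial is the increment of the Bernoulli polynomial
  over one period.\<close>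

lemma E_hat_strip_add_period:
  assumes \<tau>: "Im \<tau> > 0" and w: "- Im \<tau> < Im w" "Im w < 0"
  shows "E_hat_strip \<tau> n (w + \<tau>) = head_reflected n w + common_part \<tau> n w"
proof -
  have t1: "tail_part \<tau> n w = head_part n (w + \<tau>) + tail_part \<tau> n (w + \<tau>)"
    by (rule tail_part_rec[OF \<tau> w(1)])
  have t2: "tail_part \<tau> n (- (w + \<tau>)) = head_part n (- w) + tail_part \<tau> n (- w)"
    using tail_part_rec[OF \<tau>, of "- (w + \<tau>)" n] w by simp
  have "Im (w + \<tau>) / Im \<tau> = Im w / Im \<tau> + 1" using \<tau> by (simp add: field_simps)
  hence "(- 4 * pi * Im \<tau>) ^ n * bernoulli_poly (Suc n) (Im (w + \<tau>) / Im \<tau>) / fact (Suc n) =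
     (- 4 * pi * Im \<tau>) ^ n * (bernoulli_poly (Suc n) (Im w / Im \<tau>) + real (Suc n) * (Im w / Im \<tau>) ^ n) / fact (Suc n)"
    by (simp only: bernoulli_poly_add_1)
  also have "\<dots> = (- 4 * pi * Im \<tau>) ^ n * bernoulli_poly (Suc n) (Im w / Im \<tau>) / fact (Suc n) +
      (- 4 * pi * Im \<tau>) ^ n * (Im w / Im \<tau>) ^ n / fact n"
    by (simp add: field_simps del: of_nat_Suc)
  also have "(- 4 * pi * Im \<tau>) ^ n * (Im w / Im \<tau>) ^ n = (- 4 * pi * Im w) ^ n"
    unfolding power_mult_distrib[symmetric] using \<tau> by (simp add: mult.assoc)
  finally have b: "(- 4 * pi * Im \<tau>) ^ n * bernoulli_poly (Suc n) (Im (w + \<tau>) / Im \<tau>) / fact (Suc n) =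
     (- 4 * pi * Im \<tau>) ^ n * bernoulli_poly (Suc n) (Im w / Im \<tau>) / fact (Suc n) + (- 4 * pi * Im w) ^ n / fact n" .
  show ?thesis
    unfolding E_hat_strip_def head_reflected_def common_part_def b t1 t2
    by (simp add: ring_distribs del: fact_Suc)
qed

section \<open>Periodicity and reduction to the fundamental strip\<close>

text \<open>The floor grows by \<open>m\<close> and the indices \<open>l\<close> move along with it,
  so every summand is literally unchanged.\<close>

lemma E_hat_add_period:
  assumes \<tau>: "Im \<tau> > 0" and k: "k \<le> 0"
  shows "E_hat k (z + of_int m * \<tau>) \<tau> = E_hat k z \<tau>"
proof -
  define t where "t = Im z / Im \<tau>"
  have t: "Im (z + of_int m * \<tau>) / Im \<tau> = t + of_int m"
    using \<tau> by (simp add: t_def field_simps)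
  have fl: "\<lfloor>t + of_int m\<rfloor> = \<lfloor>t\<rfloor> + m" and fr: "frac (t + of_int m) = frac t"
    by (simp_all add: frac_def)
  have s1: "z + of_int m * \<tau> - of_int (N + m) * \<tau> = z - of_int N * \<tau>" for N
    by (simp add: algebra_simps)
  have l1: "1 + (N + m) + int j = (1 + N + int j) + m" and l2: "- (N + m) + int j = (- N + int j) - m" for N j
    by simp_all
  have f1: "of_int (l + m) - (t + of_int m) = of_int l - t"
    and f2: "of_int (l - m) + (t + of_int m) = of_int l + t" for l
    by simp_all
  have s2: "z + of_int m * \<tau> + of_int (l - m) * \<tau> = z + of_int l * \<tau>" for l
    by (simp add: algebra_simps)
  have "E_minus k (z + of_int m * \<tau>) \<tau> = E_minus k z \<tau>"
    unfolding E_minus_def Let_def t t_def[symmetric] fl l1 l2 f1 f2 s1 s2 ..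
  moreover have c: "(2 - k = 1) = False" "(2 - k = 0) = False" "(2 - k \<le> - 1) = False" "(k \<ge> 1) = False"
    using k by auto
  ultimately show ?thesis
    unfolding E_hat_def Let_def t t_def[symmetric] fl fr E_fun_def s1 c if_False by simp
qed

lemma E_hat_1_add_period:
  assumes \<tau>: "Im \<tau> > 0" and z: "z \<notin> period_lattice \<tau>"
  shows "E_hat 1 (z + of_int m * \<tau>) \<tau> = E_hat 1 z \<tau>"
proof -
  have "z + of_int m * \<tau> \<notin> period_lattice \<tau>" using z period_lattice_shift_iff by simp
  thus ?thesis
    using \<tau> z by (simp add: E_hat_def E_fun_1_eq E1_sum_add_period add_divide_distrib)
qed

lemma has_wirtinger_E_hat_fundamental_strip:
  assumes \<tau>: "Im \<tau> > 0" and z: "0 \<le> Im z" "Im z < Im \<tau>" "z \<notin> period_lattice \<tau>"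
  obtains B where "has_wirtinger (\<lambda>w. E_hat (1 - int (Suc n)) w \<tau>)
     (2 * of_real pi * \<i> * E_hat_strip \<tau> n z) B z"
proof -
  have ne: "ee z \<noteq> 1" using ee_translate_neq_1[OF z(3), of 0] by simp
  obtain B where B: "has_wirtinger (E_hat_strip \<tau> (Suc n)) (2 * of_real pi * \<i> * E_hat_strip \<tau> n z) B z"
    "Im z = 0 \<Longrightarrow> has_wirtinger (\<lambda>z. head_reflected (Suc n) z + common_part \<tau> (Suc n) z)
        (2 * of_real pi * \<i> * E_hat_strip \<tau> n z) B z"
    using has_wirtinger_E_hat_strip[OF \<tau> z(1,2) ne, of n] by blast
  have op: "open ({w. - Im \<tau> < Im w} \<inter> {w. Im w < Im \<tau>} \<inter> ee -` (- {1}))"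
    by (intro open_Int open_halfspace_Im_gt open_halfspace_Im_lt open_vimage)
       (auto simp: ee_def intro!: continuous_intros)
  show thesis
  proof (cases "Im z = 0")
    case False
    have "eventually (\<lambda>w. w \<in> {w. 0 < Im w} \<inter> ({w. - Im \<tau> < Im w} \<inter> {w. Im w < Im \<tau>} \<inter> ee -` (- {1}))) (nhds z)"
      by (rule eventually_nhds_in_open[OF open_Int[OF open_halfspace_Im_gt op]]) (use False z ne in auto)
    hence "eventually (\<lambda>w. E_hat_strip \<tau> (Suc n) w = E_hat (1 - int (Suc n)) w \<tau>) (nhds z)"
      by eventually_elim (subst E_hat_eq_strip, auto)
    from has_wirtinger_cong_ev[OF B(1) this] show thesis by (rule that)
  next
    case True
    let ?g = "\<lambda>z. head_reflected (Suc n) z + common_part \<tau> (Suc n) z"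
    have W: "has_wirtinger (\<lambda>w. if 0 \<le> Im w then E_hat_strip \<tau> (Suc n) w else ?g w)
        (2 * of_real pi * \<i> * E_hat_strip \<tau> n z) B z"
      by (rule has_wirtinger_If[OF B(1) B(2)[OF True]])
         (simp add: E_hat_strip_eq head_reflected_real[OF True])
    have "eventually (\<lambda>w. w \<in> {w. - Im \<tau> < Im w} \<inter> {w. Im w < Im \<tau>} \<inter> ee -` (- {1})) (nhds z)"
      by (rule eventually_nhds_in_open[OF op]) (use True z ne \<tau> in auto)
    hence "eventually (\<lambda>w. (if 0 \<le> Im w then E_hat_strip \<tau> (Suc n) w else ?g w) =
        E_hat (1 - int (Suc n)) w \<tau>) (nhds z)"
    proof eventually_elim
      case (elim w)
      show ?case
      proof (cases "0 \<le> Im w")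
        case True
        thus ?thesis using elim by (subst E_hat_eq_strip) auto
      next
        case False
        \<comment> \<open>Below the line \<open>E_hat\<close> is evaluated one period higher, where
          the strip formula holds.\<close>
        have "ee (w + \<tau>) \<noteq> 1" using norm_ee_less_1_iff[of "w + \<tau>"] elim by auto
        hence "E_hat (1 - int (Suc n)) (w + \<tau>) \<tau> = E_hat_strip \<tau> (Suc n) (w + \<tau>)"
          using elim False by (intro E_hat_eq_strip) auto
        also have "\<dots> = ?g w" using elim False by (intro E_hat_strip_add_period[OF \<tau>]) auto
        finally show ?thesis
          using False E_hat_add_period[OF \<tau>, of "1 - int (Suc n)" w 1] by simp
      qed
    qed
    from has_wirtinger_cong_ev[OF W this] show thesis by (rule that)
  qed
qed

lemma has_wirtinger_E_hat:
  assumes \<tau>: "Im \<tau> > 0" and z: "z \<notin> period_lattice \<tau>"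
  obtains B where "has_wirtinger (\<lambda>w. E_hat (2 - a) w \<tau>) (2 * of_real pi * \<i> * E_hat (3 - a) z \<tau>) B z"
proof -
  have F: "has_wirtinger (\<lambda>w. E_fun k w \<tau>) (2 * of_real pi * \<i> * E_fun (k + 1) z \<tau>) 0 z" if "k \<ge> 1" for k
    by (rule has_wirtinger_holomorphic[OF has_field_derivative_E_fun[OF \<tau> that z]])
  consider "a \<le> - 1" | "a = 0" | "a = 1" | "a \<ge> 2" by linarith
  thus thesis
  proof cases
    case 1
    have eq: "E_hat (2 - a) w \<tau> = E_fun (2 - a) w \<tau>" "E_hat (3 - a) w \<tau> = E_fun (2 - a + 1) w \<tau>" for w
      using 1 by (simp_all add: E_hat_def)
    have "2 - a \<ge> 1" using 1 by simp
    from F[OF this] show ?thesis by (intro that[unfolded eq])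
  next
    case 2
    have eq: "E_hat (2 - a) w \<tau> = E_fun 2 w \<tau> + 1 / of_real (4 * pi * Im \<tau>)"
      "E_hat (3 - a) w \<tau> = E_fun (2 + 1) w \<tau>" for w
      using 2 by (simp_all add: E_hat_def)
    have "has_wirtinger (\<lambda>w. 1 / of_real (4 * pi * Im \<tau>)) 0 0 z" by (simp add: has_wirtinger_def)
    from has_wirtinger_add[OF F[of 2] this]
    have "has_wirtinger (\<lambda>w. E_fun 2 w \<tau> + 1 / of_real (4 * pi * Im \<tau>))
        (2 * of_real pi * \<i> * E_fun (2 + 1) z \<tau>) 0 z" by simp
    thus ?thesis by (rule that[unfolded eq])
  next
    case 3
    have eq: "E_hat (2 - a) w \<tau> = E_fun 1 w \<tau> - of_real (Im w / Im \<tau>) + 1 / 2"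
      "E_hat (3 - a) w \<tau> = E_fun (1 + 1) w \<tau> + 1 / of_real (4 * pi * Im \<tau>)" for w
      using 3 by (simp_all add: E_hat_def)
    have c: "has_wirtinger (\<lambda>w. 1 / 2) 0 0 z" by (simp add: has_wirtinger_def)
    have "((\<lambda>y. y / Im \<tau>) has_real_derivative 1 / Im \<tau>) (at (Im z))"
      using \<tau> by (auto intro!: derivative_eq_intros)
    note D = has_wirtinger_add[OF has_wirtinger_diff[OF F[OF order_refl] has_wirtinger_Im[OF this]] c]
    \<comment> \<open>The derivative of \<open>- y / v\<close> is exactly the correction term in the
      completed function of subscript 2.\<close>
    have v: "2 * of_real pi * \<i> * (1 / of_real (4 * pi * Im \<tau>)) = \<i> / 2 * complex_of_real (1 / Im \<tau>)"
      using \<tau> by (simp add: field_simps)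
    show ?thesis
      by (rule that[unfolded eq], rule has_wirtinger_eq_rhs[OF D _ refl], unfold distrib_left v) simp
  next
    case 4
    define n where "n = nat (a - 2)"
    have a: "2 - a = 1 - int (Suc n)" "3 - a = 1 - int n" using 4 by (auto simp: n_def)
    define m where "m = - \<lfloor>Im z / Im \<tau>\<rfloor>"
    define z0 where "z0 = z + of_int m * \<tau>"
    have "Im z0 = Im \<tau> * frac (Im z / Im \<tau>)"
      using \<tau> by (simp add: z0_def m_def frac_def algebra_simps)
    hence z0: "0 \<le> Im z0" "Im z0 < Im \<tau>"
      using \<tau> frac_lt_1[of "Im z / Im \<tau>"] by simp_all
    have z0': "z0 \<notin> period_lattice \<tau>" unfolding z0_def using z by (simp add: period_lattice_shift_iff)
    \<comment> \<open>For \<open>a = 2\<close> the right-hand side has subscript 1, where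
      periodicity rests on \<open>E1_sum_add_period\<close>.\<close>
    have "E_hat (1 - int n) z \<tau> = E_hat (1 - int n) z0 \<tau>"
      unfolding z0_def using E_hat_add_period[OF \<tau>] E_hat_1_add_period[OF \<tau> z] by (cases n) auto
    also have "\<dots> = E_hat_strip \<tau> n z0"
      using E_hat_1_eq_strip[OF z0 z0'] E_hat_eq_strip[OF z0, of n] ee_translate_neq_1[OF z0', of 0]
      by (cases n) auto
    finally have E: "E_hat (1 - int n) z \<tau> = E_hat_strip \<tau> n z0" .
    obtain B where B: "has_wirtinger (\<lambda>w. E_hat (1 - int (Suc n)) w \<tau>)
       (2 * of_real pi * \<i> * E_hat_strip \<tau> n z0) B z0"
      using has_wirtinger_E_hat_fundamental_strip[OF \<tau> z0 z0', of n] by blast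
    have eq: "E_hat (1 - int (Suc n)) w \<tau> = E_hat (1 - int (Suc n)) (w + of_int m * \<tau>) \<tau>" for w
      by (rule E_hat_add_period[OF \<tau>, symmetric]) simp
    show ?thesis
    proof (rule that, unfold a E)
      show "has_wirtinger (\<lambda>w. E_hat (1 - int (Suc n)) w \<tau>) (2 * of_real pi * \<i> * E_hat_strip \<tau> n z0) B z"
        by (subst eq, rule has_wirtinger_shift) (use B in \<open>simp add: z0_def\<close>)
    qed
  qed
qed

theorem theorem1p5:
  fixes a :: int and \<tau> z :: complex
  assumes "Im \<tau> > 0" and "z \<notin> period_lattice \<tau>"
  shows "has_partials_at (\<lambda>w. E_hat (2 - a) w \<tau>) z \<and>
         Y0_plus (\<lambda>w. E_hat (2 - a) w \<tau>) z = - 2 * of_real pi * E_hat (3 - a) z \<tau>"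
proof -
  obtain B where "has_wirtinger (\<lambda>w. E_hat (2 - a) w \<tau>) (2 * of_real pi * \<i> * E_hat (3 - a) z \<tau>) B z"
    using has_wirtinger_E_hat[OF assms] by blast
  note P = has_wirtinger_imp_partials[OF this]
  have "\<i> * (2 * of_real pi * \<i> * c) = - 2 * of_real pi * c" for c
    by (simp add: complex_eq_iff)
  with P(1) show ?thesis
    unfolding Y0_plus_def P(2) by blast
qed

end
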